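(* Let $F$ be a totally real number field of degree $n$, $B$ a totally indefinite quaternion division algebra over $F$, $\mathcal{O}$ a hereditary order in $B$, and $A$ a complex abelian variety with quaternionic multiplication by $\mathcal{O}$, $A(\mathbb{C})=V/\mathcal{I}\cdot v_0$ with $v_0=(\tau_{\sigma_1},1,\dots,\tau_{\sigma_n},1)^t$ as in the context. Let $\mathcal{L}\in\mathrm{NS}(A)$ be nondegenerate, with associated pure quaternion $\mu=\mu(\mathcal{L})$. Then the index of $\mathcal{L}$ is $$i(\mathcal{L})=\sum_{\sigma:F\hookrightarrow\mathbb{R}}i_\sigma(\mu).$$
   Context: $B$ totally indefinite: split at all real places. $A$ has quaternionic multiplication by $\mathcal{O}$ if $\dim A=2n$ and $\mathrm{End}(A)\cong\mathcal{O}$. Fix $B\otimes_{\mathbb{Q}}\mathbb{R}\cong\bigoplus_\sigma M_2(\mathbb{R})$, $\beta\mapsto(\beta^\sigma)$; then $A(\mathbb{C})=V/\Lambda$, $V=\mathbb{C}^{2n}$, $B$ acting by $\mathrm{diag}(\beta^{\sigma_1},\dots,\beta^{\sigma_n})$, $\Lambda=\mathcal{I}\cdot v_0$ with $\mathcal{I}$ a left $\mathcal{O}$-ideal and $v_0=(\tau_{\sigma_1},1,\dots,\tau_{\sigma_n},1)^t$, $\mathrm{Im}\,\tau_\sigma\ne0$. For $\mathcal{L}$ with Riemann form $E=c_1(\mathcal{L})$, $\mu(\mathcal{L})$ is the unique $\mu\in B$ with $E(\beta v_0,v_0)=\mathrm{tr}_{B/\mathbb{Q}}(\mu\beta)$ for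 all $\beta\in B$; it has reduced trace $0$, so $\mu^2+\delta=0$ with $\delta\in F$, $\delta\neq0$ if $\mathcal{L}$ is nondegenerate. The index $i(\mathcal{L})$ is the unique $i$ with $H^i(A,\mathcal{L})\neq0$ (equivalently the number of negative eigenvalues of the hermitian form of $\mathcal{L}$). For each $\sigma$ choose $\nu_\sigma\in\mathrm{GL}_2(\mathbb{R})$ with $\nu_\sigma\mu^\sigma\nu_\sigma^{-1}=\omega_\sigma$, where $\omega_\sigma=\begin{pmatrix}0&\sqrt{\sigma(\delta)}\\-\sqrt{\sigma(\delta)}&0\end{pmatrix}$ if $\sigma(\delta)>0$ and $\omega_\sigma=\mathrm{diag}(\sqrt{\sigma(-\delta)},-\sqrt{\sigma(-\delta)})$ otherwise (the sign of $\det\nu_\sigma$ depends only on $\mu$). Define $i_\sigma(\mu)=0$ if $\sigma(\delta)>0$ and $\det(\nu_\sigma)\mathrm{Im}(\tau_\sigma)>0$; $i_\sigma(\mu)=1$ if $\sigma(\delta)<0$; $i_\sigma(\mu)=2$ if $\sigma(\delta)>0$ and $\det(\nu_\sigma)\mathrm{Im}(\tau_\sigma)<0$. *)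

theory Defs
  imports "HOL-Analysis.Analysis"
begin

section \<open>The totally real field\<close>

definition is_ring_hom :: "('a::ring_1 \<Rightarrow> 'b::ring_1) \<Rightarrow> bool" where
  "is_ring_hom f \<longleftrightarrow> f 1 = 1 \<and> (\<forall>x y. f (x + y) = f x + f y) \<and> (\<forall>x y. f (x * y) = f x * f y)"

definition real_embeddings :: "('f::field_char_0 \<Rightarrow> real) set" where
  "real_embeddings = {\<sigma>. is_ring_hom \<sigma>}"

definition field_degree :: "'f::field_char_0 itself \<Rightarrow> nat" where
  "field_degree _ = vector_space.dim (\<lambda>q x. of_rat q * x) (UNIV :: 'f set)"

text \<open>
  The dimension of an infinite-dimensional space is \<open>0\<close> by convention, so positivity of the
  degree expresses finiteness over the rationals.
\<close>

definition totally_real_number_field :: "'f::field_char_0 itself \<Rightarrow> bool" where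
  "totally_real_number_field T \<longleftrightarrow>
     field_degree T > 0 \<and> (\<forall>\<phi> :: 'f \<Rightarrow> complex. is_ring_hom \<phi> \<longrightarrow> range \<phi> \<subseteq> \<real>)"

text \<open>
  The trace as the sum of all conjugates.  For a totally real field all embeddings are real;
  the rational value is regarded as a real number.
\<close>

definition field_trace :: "'f::field_char_0 \<Rightarrow> real" where
  "field_trace x = (\<Sum>\<sigma>\<in>real_embeddings. \<sigma> x)"


section \<open>Quaternion algebras\<close>

text \<open>
  The algebra is a type, made into an algebra over the field by the map \<open>\<iota>\<close> onto its centre.
  That it is a division algebra is expressed by the type class of \<open>'b\<close>.
\<close>

definition quaternion_algebra :: "('f::field_char_0 \<Rightarrow> 'b::division_ring) \<Rightarrow> bool" where
  "quaternion_algebra \<iota> \<longleftrightarrow>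
     is_ring_hom \<iota> \<and> range \<iota> = {z. \<forall>x. z * x = x * z} \<and>
     vector_space.dim (\<lambda>a x. \<iota> a * x) UNIV = 4"

text \<open>
  A map \<open>r\<close> as below is the same thing as an isomorphism of real algebras from the scalar
  extension of the quaternion algebra along \<open>\<sigma>\<close> to the real 2x2 matrices; the last clause is
  the bijectivity of the linear extension of \<open>r\<close>.
\<close>

definition splitting ::
    "('f::field_char_0 \<Rightarrow> 'b::division_ring) \<Rightarrow> ('f \<Rightarrow> real) \<Rightarrow> ('b \<Rightarrow> real^2^2) \<Rightarrow> bool" where
  "splitting \<iota> \<sigma> r \<longleftrightarrow>
     r 1 = mat 1 \<and> (\<forall>x y. r (x + y) = r x + r y) \<and> (\<forall>x y. r (x * y) = r x ** r y) \<and>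
     (\<forall>a. r (\<iota> a) = mat (\<sigma> a)) \<and>
     (\<forall>S. \<not> module.dependent (\<lambda>a x. \<iota> a * x) S \<and> module.span (\<lambda>a x. \<iota> a * x) S = UNIV \<longrightarrow>
        inj_on r S \<and> independent (r ` S) \<and> span (r ` S) = UNIV)"

definition totally_indefinite :: "('f::field_char_0 \<Rightarrow> 'b::division_ring) \<Rightarrow> bool" where
  "totally_indefinite \<iota> \<longleftrightarrow> (\<forall>\<sigma>\<in>real_embeddings. \<exists>r. splitting \<iota> \<sigma> r)"

text \<open>
  A noncentral quaternion has a minimal polynomial \<open>X\<^sup>2 - t X + m\<close> over the centre, and \<open>t\<close> is its
  reduced trace.
\<close>

definition reduced_trace :: "('f::field_char_0 \<Rightarrow> 'b::division_ring) \<Rightarrow> 'b \<Rightarrow> 'f" where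
  "reduced_trace \<iota> x =
     (if x \<in> range \<iota> then 2 * (THE a. \<iota> a = x)
      else (THE t. \<exists>m. x * x - \<iota> t * x + \<iota> m = 0))"

definition quaternion_trace :: "('f::field_char_0 \<Rightarrow> 'b::division_ring) \<Rightarrow> 'b \<Rightarrow> real" where
  "quaternion_trace \<iota> x = field_trace (reduced_trace \<iota> x)"


section \<open>Orders and ideals\<close>

text \<open>Full lattices over the ring of integers of the centre.\<close>

definition quaternion_lattice ::
    "('f::field_char_0 \<Rightarrow> 'b::division_ring) \<Rightarrow> 'b set \<Rightarrow> bool" where
  "quaternion_lattice \<iota> L \<longleftrightarrow>
     (\<exists>S. finite S \<and> L = {\<Sum>s\<in>S. \<iota> (c s) * s | c. \<forall>s\<in>S. algebraic_int (c s)}) \<and>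
     module.span (\<lambda>a x. \<iota> a * x) L = UNIV"

definition quaternion_order ::
    "('f::field_char_0 \<Rightarrow> 'b::division_ring) \<Rightarrow> 'b set \<Rightarrow> bool" where
  "quaternion_order \<iota> R \<longleftrightarrow>
     quaternion_lattice \<iota> R \<and> 1 \<in> R \<and> (\<forall>x\<in>R. \<forall>y\<in>R. x * y \<in> R)"

definition left_order_ideal ::
    "('f::field_char_0 \<Rightarrow> 'b::division_ring) \<Rightarrow> 'b set \<Rightarrow> 'b set \<Rightarrow> bool" where
  "left_order_ideal \<iota> R I \<longleftrightarrow> quaternion_lattice \<iota> I \<and> (\<forall>a\<in>R. \<forall>x\<in>I. a * x \<in> I)"

text \<open>
  In the next three definitions \<open>m a x\<close> is the action of the scalar \<open>a\<close> on \<open>x\<close>, so that left and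
  right modules are treated alike: \<open>m\<close> is the multiplication or its opposite.
  A module is projective if it is a direct summand of a free module.  The free module has the
  type of the ring as its index type, which is no restriction for ideals, since a generating
  set can serve as the index set.
\<close>

definition one_sided_ideal :: "('b \<Rightarrow> 'b \<Rightarrow> 'b) \<Rightarrow> 'b::division_ring set \<Rightarrow> 'b set \<Rightarrow> bool" where
  "one_sided_ideal m R J \<longleftrightarrow>
     J \<subseteq> R \<and> 0 \<in> J \<and> (\<forall>x\<in>J. \<forall>y\<in>J. x + y \<in> J) \<and> (\<forall>a\<in>R. \<forall>x\<in>J. m a x \<in> J)"

definition free_module :: "'b::division_ring set \<Rightarrow> 'b set \<Rightarrow> ('b \<Rightarrow> 'b) set" where
  "free_module R X = {c. finite {x. c x \<noteq> 0} \<and> range c \<subseteq> R \<and> (\<forall>x. x \<notin> X \<longrightarrow> c x = 0)}"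

definition projective_ideal :: "('b \<Rightarrow> 'b \<Rightarrow> 'b) \<Rightarrow> 'b::division_ring set \<Rightarrow> 'b set \<Rightarrow> bool" where
  "projective_ideal m R J \<longleftrightarrow>
     (\<exists>X s p.
        (\<forall>x\<in>J. s x \<in> free_module R X) \<and>
        (\<forall>x\<in>J. \<forall>y\<in>J. s (x + y) = (\<lambda>z. s x z + s y z)) \<and>
        (\<forall>a\<in>R. \<forall>x\<in>J. s (m a x) = (\<lambda>z. m a (s x z))) \<and>
        (\<forall>c\<in>free_module R X. p c \<in> J) \<and>
        (\<forall>c\<in>free_module R X. \<forall>d\<in>free_module R X. p (\<lambda>z. c z + d z) = p c + p d) \<and>
        (\<forall>a\<in>R. \<forall>c\<in>free_module R X. p (\<lambda>z. m a (c z)) = m a (p c)) \<and>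
        (\<forall>x\<in>J. p (s x) = x))"

definition hereditary :: "'b::division_ring set \<Rightarrow> bool" where
  "hereditary R \<longleftrightarrow>
     (\<forall>J. one_sided_ideal (\<lambda>a x. a * x) R J \<longrightarrow> projective_ideal (\<lambda>a x. a * x) R J) \<and>
     (\<forall>J. one_sided_ideal (\<lambda>a x. x * a) R J \<longrightarrow> projective_ideal (\<lambda>a x. x * a) R J)"


section \<open>Complex tori, line bundles and the index\<close>

text \<open>
  The vector space is \<open>complex^'d\<close> with complex scalar multiplication \<open>*s\<close>; the torus is its
  quotient by \<open>\<Lambda>\<close>.
\<close>

definition full_lattice :: "(complex^'d::finite) set \<Rightarrow> bool" where
  "full_lattice \<Lambda> \<longleftrightarrow>
     (\<exists>S. independent S \<and> span S = UNIV \<and> \<Lambda> = {\<Sum>b\<in>S. of_int (c b) *\<^sub>R b | c :: _ \<Rightarrow> int. True})"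

definition torus_endomorphisms ::
    "(complex^'d::finite) set \<Rightarrow> (complex^'d \<Rightarrow> complex^'d) set" where
  "torus_endomorphisms \<Lambda> = {f. Vector_Spaces.linear (*s) (*s) f \<and> f ` \<Lambda> \<subseteq> \<Lambda>}"

text \<open>
  An element of the Neron-Severi group is given by its first Chern class, an alternating
  Riemann form \<open>E\<close>.  The associated hermitian form is \<open>E(ix, y) + i E(x, y)\<close>, which is
  linear in \<open>x\<close>.
\<close>

definition neron_severi ::
    "(complex^'d::finite) set \<Rightarrow> (complex^'d \<Rightarrow> complex^'d \<Rightarrow> real) set" where
  "neron_severi \<Lambda> =
     {E. bilinear E \<and> (\<forall>x. E x x = 0) \<and> (\<forall>x y. E (\<i> *s x) (\<i> *s y) = E x y) \<and>
         (\<forall>x\<in>\<Lambda>. \<forall>y\<in>\<Lambda>. E x y \<in> \<int>)}"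

definition nondegenerate :: "(complex^'d::finite \<Rightarrow> complex^'d \<Rightarrow> real) \<Rightarrow> bool" where
  "nondegenerate E \<longleftrightarrow> (\<forall>x. (\<forall>y. E x y = 0) \<longrightarrow> x = 0)"

definition hermitian_form ::
    "(complex^'d::finite \<Rightarrow> complex^'d \<Rightarrow> real) \<Rightarrow> complex^'d \<Rightarrow> complex^'d \<Rightarrow> complex" where
  "hermitian_form E x y = of_real (E (\<i> *s x) y) + \<i> * of_real (E x y)"

definition polarization ::
    "(complex^'d::finite) set \<Rightarrow> (complex^'d \<Rightarrow> complex^'d \<Rightarrow> real) \<Rightarrow> bool" where
  "polarization \<Lambda> E \<longleftrightarrow> E \<in> neron_severi \<Lambda> \<and> (\<forall>x. x \<noteq> 0 \<longrightarrow> Re (hermitian_form E x x) > 0)"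

definition abelian_variety :: "(complex^'d::finite) set \<Rightarrow> bool" where
  "abelian_variety \<Lambda> \<longleftrightarrow> full_lattice \<Lambda> \<and> (\<exists>E. polarization \<Lambda> E)"

text \<open>The matrix \<open>M\<close> for which the form is \<open>(x, y) \<mapsto> y\<^sup>* M x\<close>.\<close>

definition hermitian_matrix ::
    "(complex^'d::finite \<Rightarrow> complex^'d \<Rightarrow> real) \<Rightarrow> complex^'d^'d" where
  "hermitian_matrix E = (\<chi> p q. hermitian_form E (axis q 1) (axis p 1))"

text \<open>
  The number of negative eigenvalues, with multiplicity.  The multiplicity of an eigenvalue is
  the dimension of its eigenspace, the matrix being hermitian.
  For a nondegenerate line bundle this number is the unique degree in which its cohomology does
  not vanish, by the index theorem of Mumford.
\<close>

definition line_bundle_index :: "(complex^'d::finite \<Rightarrow> complex^'d \<Rightarrow> real) \<Rightarrow> nat" where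
  "line_bundle_index E =
     (\<Sum>r \<in> {r :: real. r < 0 \<and> (\<exists>v. v \<noteq> 0 \<and> hermitian_matrix E *v v = of_real r *s v)}.
        vec.dim {v. hermitian_matrix E *v v = of_real r *s v})"


section \<open>Quaternionic multiplication\<close>

text \<open>
  The embeddings are enumerated by \<open>emb\<close>; coordinates of the complex vector space are indexed by
  pairs in \<open>'n \<times> 2\<close>, the second component being the position inside a 2x2 block.
\<close>

definition block_diag ::
    "('n::finite \<Rightarrow> 'f \<Rightarrow> real) \<Rightarrow> (('f \<Rightarrow> real) \<Rightarrow> 'b \<Rightarrow> real^2^2) \<Rightarrow> 'b
      \<Rightarrow> complex^('n \<times> 2)^('n \<times> 2)" where
  "block_diag emb \<rho> \<beta> =
     (\<chi> p q. if fst p = fst q then of_real (\<rho> (emb (fst p)) \<beta> $ snd p $ snd q) else 0)"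

definition base_vector ::
    "('n::finite \<Rightarrow> 'f \<Rightarrow> real) \<Rightarrow> (('f \<Rightarrow> real) \<Rightarrow> complex) \<Rightarrow> complex^('n \<times> 2)" where
  "base_vector emb \<tau> = (\<chi> p. if snd p = 1 then \<tau> (emb (fst p)) else 1)"

definition qm_lattice ::
    "('n::finite \<Rightarrow> 'f \<Rightarrow> real) \<Rightarrow> (('f \<Rightarrow> real) \<Rightarrow> 'b \<Rightarrow> real^2^2) \<Rightarrow> (('f \<Rightarrow> real) \<Rightarrow> complex)
      \<Rightarrow> 'b set \<Rightarrow> (complex^('n \<times> 2)) set" where
  "qm_lattice emb \<rho> \<tau> I = (\<lambda>\<beta>. block_diag emb \<rho> \<beta> *v base_vector emb \<tau>) ` I"

text \<open>
  The action of \<open>R\<close> identifies \<open>R\<close> with the full endomorphism ring of the torus.  It respects the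
  ring structure because the splittings \<open>\<rho>\<close> do.  The torus has dimension \<open>2 n\<close> by its type.
\<close>

definition quaternionic_multiplication ::
    "('n::finite \<Rightarrow> 'f \<Rightarrow> real) \<Rightarrow> (('f \<Rightarrow> real) \<Rightarrow> 'b \<Rightarrow> real^2^2) \<Rightarrow> 'b set
      \<Rightarrow> (complex^('n \<times> 2)) set \<Rightarrow> bool" where
  "quaternionic_multiplication emb \<rho> R \<Lambda> \<longleftrightarrow>
     bij_betw (\<lambda>\<beta>. (*v) (block_diag emb \<rho> \<beta>)) R (torus_endomorphisms \<Lambda>)"

definition line_bundle_quaternion ::
    "('f::field_char_0 \<Rightarrow> 'b::division_ring) \<Rightarrow> ('n::finite \<Rightarrow> 'f \<Rightarrow> real)
      \<Rightarrow> (('f \<Rightarrow> real) \<Rightarrow> 'b \<Rightarrow> real^2^2) \<Rightarrow> (('f \<Rightarrow> real) \<Rightarrow> complex)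
      \<Rightarrow> (complex^('n \<times> 2) \<Rightarrow> complex^('n \<times> 2) \<Rightarrow> real) \<Rightarrow> 'b" where
  "line_bundle_quaternion \<iota> emb \<rho> \<tau> E =
     (THE \<mu>. \<forall>\<beta>. E (block_diag emb \<rho> \<beta> *v base_vector emb \<tau>) (base_vector emb \<tau>)
                = quaternion_trace \<iota> (\<mu> * \<beta>))"

definition quaternion_delta :: "('f::field_char_0 \<Rightarrow> 'b::division_ring) \<Rightarrow> 'b \<Rightarrow> 'f" where
  "quaternion_delta \<iota> \<mu> = (THE \<delta>. \<mu> * \<mu> + \<iota> \<delta> = 0)"

definition omega :: "real \<Rightarrow> real^2^2" where
  "omega d = (if d > 0 then vector [vector [0, sqrt d], vector [- sqrt d, 0]]
              else vector [vector [sqrt (- d), 0], vector [0, - sqrt (- d)]])"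

text \<open>
  Here \<open>d\<close> is the value \<open>\<sigma>(\<delta>)\<close>, \<open>N\<close> the conjugating matrix and \<open>t\<close> the complex number
  belonging to \<open>\<sigma>\<close>.
\<close>

definition local_index :: "real \<Rightarrow> real^2^2 \<Rightarrow> complex \<Rightarrow> nat" where
  "local_index d N t =
     (if d > 0 \<and> det N * Im t > 0 then 0
      else if d < 0 then 1
      else if d > 0 \<and> det N * Im t < 0 then 2
      else undefined)"

end

(*
  By a polarization, every form on the torus that is rational on the lattice and compatible with
  the complex structure comes from an endomorphism, hence from the order.  Applied to the forms
  E0(x, b y), this gives the adjoint b' of b for the polarization E0.  Positivity forces this
  adjoint to fix the centre, so the blocks belonging to different embeddings are orthogonal for
  E0, and the adjoint being given by real matrices forces the diagonal blocks to be real.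
  Applied to E itself, it shows that the hermitian matrix of E is block diagonal with real
  symmetric 2x2 blocks P.  Comparing E(b v0, v0) with the trace form yields that mu is Im(tau) J P
  in each embedding, with J = [[0, 1], [-1, 0]].  So delta is Im(tau)^2 det P, and if it is
  positive, then nu mu nu^-1 = sqrt(delta) J gives Im(tau) det(nu) P = sqrt(delta) nu^T nu: the
  number of negative eigenvalues of each block is its local index.
*)

theory Submission
  imports Defs
begin

section \<open>Linear algebra and the index of a diagonalizable form\<close>

text \<open>The trace identity for \<mu> describes \<open>E\<close> only against the single vector
  \<open>v0\<close>, and no adjunction rule for the algebra is built into
  \<open>neron_severi\<close>; so the identity alone cannot exclude non-real entries, or entries
  between different embeddings, in the hermitian matrix. What excludes them is that \<open>R\<close>
  is the whole endomorphism ring, and the detour through a polarization is how that hypothesis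
  reaches the forms. Representability of functionals by a nondegenerate form is needed over two
  fields for this: over the reals it yields a complex linear map, over the rationals it shows that
  this map preserves the rational span of the lattice, so that a multiple of it is an endomorphism.
  Much of the remaining work comes from definite descriptions: \<mu>, \<delta> and the reduced trace
  are given by \<open>THE\<close>, so each needs existence and uniqueness. Existence of \<mu> in the
  algebra rests on the rationality of traces; for the other two, Cayley-Hamilton for the real
  matrices has to be carried back to the algebra with coefficients in the field.\<close>

lemma (in vector_space) nondegenerate_form_represents:
  assumes S: "finite S" "span S = UNIV"
    and lin1: "\<And>y. Vector_Spaces.linear scale (*) (\<lambda>x. f x y)"
    and lin2: "\<And>x. Vector_Spaces.linear scale (*) (f x)"
    and nondeg: "\<And>x. (\<And>y. f x y = 0) \<Longrightarrow> x = 0"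
    and g: "Vector_Spaces.linear scale (*) g"
  shows "\<exists>x. \<forall>y. g y = f x y"
proof -
  obtain B where B: "B \<subseteq> S" "independent B" "span B = UNIV"
    using maximal_independent_subset[of S] S by (metis span_minimal span_UNIV subset_antisym subspace_span top_greatest)
  have fB: "finite B" using B S finite_subset by blast
  interpret fd: finite_dimensional_vector_space scale B
    by unfold_locales (use B fB in auto)
  \<comment> \<open>Functionals are encoded as vectors of the space itself: the coordinates of
    \<open>\<phi> x\<close> in the basis \<open>B\<close> are the values of \<open>f x\<close> on
    \<open>B\<close>. Nondegeneracy makes this endomorphism injective, and finite dimension then
    makes it onto.\<close>
  define \<phi> where "\<phi> = (\<lambda>x. \<Sum>u\<in>B. scale (f x u) u)"
  have f1: "f (x + x') y = f x y + f x' y" "f (scale c x) y = c * f x y" for x x' y c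
    using lin1[of y] by (auto simp: Vector_Spaces.linear_iff)
  have uniq: "\<forall>u\<in>B. a u = b u" if "(\<Sum>u\<in>B. scale (a u) u) = (\<Sum>u\<in>B. scale (b u) u)" for a b
  proof -
    have "(\<Sum>u\<in>B. scale (a u - b u) u) = 0"
      using that by (simp add: scale_left_diff_distrib sum_subtractf)
    then show ?thesis using independentD[OF B(2) fB, of "\<lambda>u. a u - b u"] by auto
  qed
  have lin\<phi>: "Vector_Spaces.linear scale scale \<phi>"
    unfolding Vector_Spaces.linear_iff \<phi>_def using vector_space_axioms
    by (auto simp: f1 scale_left_distrib sum.distrib scale_sum_right)
  have ext: "h = k" if h: "Vector_Spaces.linear scale (*) h" and k: "Vector_Spaces.linear scale (*) k"
    and eq: "\<And>u. u \<in> B \<Longrightarrow> h u = k u" for h k :: "'b \<Rightarrow> 'a"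
  proof
    fix x
    interpret vp: vector_space_pair scale "(*)"
      using h by (simp add: Vector_Spaces.linear_iff vector_space_pair_def)
    show "h x = k x"
      by (rule vp.linear_eq_on[OF h k, of _ B]) (use eq B in auto)
  qed
  have zero: "Vector_Spaces.linear scale (*) (\<lambda>_. 0 :: 'a)"
    using g by (auto simp: Vector_Spaces.linear_iff)
  have "inj \<phi>"
  proof (rule injI)
    fix x y assume "\<phi> x = \<phi> y"
    then have 1: "\<And>u. u \<in> B \<Longrightarrow> f x u = f y u" unfolding \<phi>_def using uniq by blast
    then have "f x = f y" using ext[OF lin2 lin2] by blast
    then have "f (x + scale (-1) y) z = 0" for z by (simp only: f1) simp
    then have "x + scale (-1) y = 0" using nondeg by blast
    then show "x = y" by simp
  qed
  then have "surj \<phi>" using fd.linear_inj_imp_surj[OF lin\<phi>] by simp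
  then obtain x where "\<phi> x = (\<Sum>u\<in>B. scale (g u) u)" by (metis surjD)
  then have "\<forall>u\<in>B. f x u = g u" unfolding \<phi>_def using uniq by blast
  then have "f x = g" using ext[OF lin2 g] by blast
  then show ?thesis by auto
qed

text \<open>Artin's subtraction: the relation at \<open>y * x\<close> minus \<open>s y\<close> times
  the relation at \<open>x\<close> has no term for \<open>s\<close>, and its coefficients
  \<open>c \<sigma> * (\<sigma> y - s y)\<close> vanish by induction. A \<open>y\<close> separating
  \<open>\<sigma>\<close> from \<open>s\<close> then kills \<open>c \<sigma>\<close>.\<close>

lemma ring_hom_independence:
  fixes c :: "('f::field \<Rightarrow> 'k::field) \<Rightarrow> 'k"
  assumes "finite A" "\<forall>\<sigma>\<in>A. is_ring_hom \<sigma>" "\<And>x. (\<Sum>\<sigma>\<in>A. c \<sigma> * \<sigma> x) = 0"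
  shows "\<forall>\<sigma>\<in>A. c \<sigma> = 0"
  using assms
proof (induction A arbitrary: c rule: finite_induct)
  case (insert s A)
  have hom: "\<sigma> (x * y) = \<sigma> x * \<sigma> y" if "\<sigma> \<in> insert s A" for \<sigma> x y
    using insert.prems(1) that unfolding is_ring_hom_def by blast
  have "\<forall>\<sigma>\<in>A. c \<sigma> * (\<sigma> y - s y) = 0" for y
  proof (rule insert.IH)
    show "\<forall>\<sigma>\<in>A. is_ring_hom \<sigma>" using insert.prems by auto
    fix x
    have e: "c s * s z = - (\<Sum>\<sigma>\<in>A. c \<sigma> * \<sigma> z)" for z
      using insert.prems(2)[of z] insert.hyps by (simp add: eq_neg_iff_add_eq_0)
    have "(\<Sum>\<sigma>\<in>A. c \<sigma> * \<sigma> y * \<sigma> x) = (\<Sum>\<sigma>\<in>A. c \<sigma> * \<sigma> (y * x))"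
      by (rule sum.cong) (auto simp: hom)
    also have "\<dots> = - (c s * s (y * x))" using e[of "y * x"] by simp
    also have "\<dots> = s y * - (c s * s x)" by (simp add: hom)
    also have "\<dots> = s y * (\<Sum>\<sigma>\<in>A. c \<sigma> * \<sigma> x)" using e[of x] by simp
    finally show "(\<Sum>\<sigma>\<in>A. c \<sigma> * (\<sigma> y - s y) * \<sigma> x) = 0"
      by (simp add: algebra_simps sum_subtractf sum_distrib_left)
  qed
  then have A0: "\<forall>\<sigma>\<in>A. c \<sigma> = 0" using insert.hyps by (metis ext eq_iff_diff_eq_0 mult_eq_0_iff)
  moreover have "c s = 0"
    using insert.prems(2)[of 1] insert.prems(1) insert.hyps A0
    by (simp add: is_ring_hom_def)
  ultimately show ?case by auto
qed simp

text \<open>The index is defined through dimensions of eigenspaces, which any similarity preserves,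
  so \<open>U\<close> may be an arbitrary invertible matrix rather than a unitary one. The
  eigenspace of \<open>r\<close> is the image under \<open>U\<close> of the coordinate subspace
  spanned by the axes with \<open>D i = r\<close>.\<close>

lemma line_bundle_index_eq_card:
  fixes E :: "complex^'d::finite \<Rightarrow> complex^'d \<Rightarrow> real" and D :: "'d \<Rightarrow> real"
  assumes U: "invertible U"
    and MU: "hermitian_matrix E ** U = U ** (\<chi> i j. if i = j then of_real (D i) else 0)"
  shows "line_bundle_index E = card {i. D i < 0}"
proof -
  let ?M = "hermitian_matrix E"
  let ?D = "(\<chi> i j. if i = j then of_real (D i) else 0) :: complex^'d^'d"
  have inj: "inj ((*v) U)" using U by (simp add: inj_matrix_vector_mult)
  have surj: "surj ((*v) U)"
  proof -
    obtain V where "U ** V = mat 1" using U by (auto simp: invertible_def)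
    then have "U *v (V *v v) = v" for v by (simp add: matrix_vector_mul_assoc)
    then show ?thesis by (metis surjI)
  qed
  have Dw: "(?D *v w) $ i = of_real (D i) * w $ i" for w :: "complex^'d" and i
    by (simp add: matrix_vector_mult_def if_distrib[of "\<lambda>x. x * _"] cong: if_cong)
  have eig: "?M *v (U *v w) = of_real r *s (U *v w) \<longleftrightarrow> (\<forall>i. i \<notin> {i. D i = r} \<longrightarrow> w $ i = 0)" for w r
  proof -
    have "?M *v (U *v w) = of_real r *s (U *v w) \<longleftrightarrow> U *v (?D *v w) = U *v (of_real r *s w)"
      by (simp only: matrix_vector_mul_assoc MU vector_scalar_commute)
    also have "\<dots> \<longleftrightarrow> ?D *v w = of_real r *s w" by (rule inj_eq[OF inj])
    also have "\<dots> \<longleftrightarrow> (\<forall>i. i \<notin> {i. D i = r} \<longrightarrow> w $ i = 0)"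
      by (auto simp: vec_eq_iff Dw)
    finally show ?thesis .
  qed
  have space: "{v. ?M *v v = of_real r *s v} = (*v) U ` {w. \<forall>i. i \<notin> {i. D i = r} \<longrightarrow> w $ i = 0}" for r
  proof (intro equalityI subsetI)
    fix v assume v: "v \<in> {v. ?M *v v = of_real r *s v}"
    obtain w where "v = U *v w" using surj by (metis surjD)
    moreover from this v have "\<forall>i. i \<notin> {i. D i = r} \<longrightarrow> w $ i = 0" using eig[of w r] by simp
    ultimately show "v \<in> (*v) U ` {w. \<forall>i. i \<notin> {i. D i = r} \<longrightarrow> w $ i = 0}" by (intro image_eqI) simp_all
  next
    fix v assume "v \<in> (*v) U ` {w. \<forall>i. i \<notin> {i. D i = r} \<longrightarrow> w $ i = 0}"
    then obtain w where "v = U *v w" "\<forall>i. i \<notin> {i. D i = r} \<longrightarrow> w $ i = 0" by blast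
    then show "v \<in> {v. ?M *v v = of_real r *s v}" using eig[of w r] by simp
  qed
  have dim: "vec.dim {v. ?M *v v = of_real r *s v} = card {i. D i = r}" for r
  proof -
    have "vec.dim ((*v) U ` {w. \<forall>i. i \<notin> {i. D i = r} \<longrightarrow> w $ i = 0})
        = vec.dim {w :: complex^'d. \<forall>i. i \<notin> {i. D i = r} \<longrightarrow> w $ i = 0}"
      using inj by (intro vec.dim_image_eq matrix_vector_mul_linear_gen) (auto intro: inj_on_subset)
    then show ?thesis unfolding space by (simp only: dim_substandard_cart)
  qed
  have vals: "{r. r < 0 \<and> (\<exists>v. v \<noteq> 0 \<and> ?M *v v = of_real r *s v)} = D ` {i. D i < 0}" (is "?L = ?R")
  proof (intro equalityI subsetI)
    fix r assume "r \<in> ?L"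
    then obtain v where v: "r < 0" "v \<noteq> 0" "?M *v v = of_real r *s v" by blast
    obtain w where w: "v = U *v w" using surj by (metis surjD)
    with v have "w \<noteq> 0" by auto
    then obtain i where "w $ i \<noteq> 0" by (auto simp: vec_eq_iff)
    then have "D i = r" using eig[of w r] v(3) w by auto
    with v(1) show "r \<in> ?R" by auto
  next
    fix r assume "r \<in> ?R"
    then obtain i where i: "r = D i" "D i < 0" by blast
    have "?M *v (U *v axis i 1) = of_real r *s (U *v axis i 1)"
      unfolding eig by (auto simp: axis_def i)
    moreover have "U *v axis i 1 \<noteq> 0"
    proof
      assume "U *v axis i 1 = 0"
      then have "U *v axis i 1 = U *v 0" by simp
      then have "axis i (1 :: complex) = 0" using inj by (blast dest: injD)
      then show False by (simp add: axis_eq_0_iff)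
    qed
    ultimately show "r \<in> ?L" using i by blast
  qed
  have "line_bundle_index E = (\<Sum>r\<in>D ` {i. D i < 0}. card {i. D i = r})"
    unfolding line_bundle_index_def vals by (simp only: dim)
  also have "\<dots> = (\<Sum>r\<in>D ` {i. D i < 0}. \<Sum>i | i \<in> {i. D i < 0} \<and> D i = r. 1)"
    by (rule sum.cong) (auto intro!: arg_cong[of _ _ card])
  also have "\<dots> = (\<Sum>i\<in>{i. D i < 0}. 1)"
    by (rule sum.image_gen[symmetric]) simp
  finally show ?thesis by simp
qed

text \<open>Product and sum of the eigenvalues are the determinant and the trace, and these two
  numbers decide how many eigenvalues are negative.\<close>

lemma symmetric_2x2_diagonalizable:
  fixes P :: "real^2^2"
  assumes sym: "P $ 1 $ 2 = P $ 2 $ 1" and det: "det P \<noteq> 0"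
  shows "\<exists>U D. det U \<noteq> 0 \<and> P ** U = U ** (\<chi> i j. if i = j then D i else 0) \<and>
    card {i. D i < (0::real)} = (if det P < 0 then 1 else if P $ 1 $ 1 > 0 then 0 else 2)"
proof -
  define a b c where abc: "a = P$1$1" "b = P$1$2" "c = P$2$2"
  have P: "P$1$1 = a" "P$1$2 = b" "P$2$1 = b" "P$2$2 = c" using sym by (auto simp: abc)
  have dP: "det P = a * c - b\<^sup>2" by (simp add: det_2 P power2_eq_square)
  have count: "card {i. D i < 0} = (if x * y < 0 then 1 else if x + y > 0 then 0 else 2)"
    if "D 1 = x" "D 2 = y" "x * y \<noteq> 0" for D :: "2 \<Rightarrow> real" and x y
  proof -
    have "{i. D i < 0} = (if x < 0 then {1} else {}) \<union> (if y < 0 then {2} else {})"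
    proof (rule set_eqI)
      fix i show "i \<in> {i. D i < 0} \<longleftrightarrow> i \<in> (if x < 0 then {1} else {}) \<union> (if y < 0 then {2} else {})"
        using that exhaust_2[of i] by auto
    qed
    then show ?thesis using that by (auto simp: mult_less_0_iff)
  qed
  \<comment> \<open>Here \<open>a * c > b^2\<close>, so \<open>a\<close> and \<open>c\<close> have
    the same sign, and the sign of the trace can be read off from either.\<close>
  have sgn: "P$1$1 > 0 \<longleftrightarrow> a + c > 0" if "\<not> det P < 0"
  proof -
    have "a * c > 0" using that det dP by (smt (verit) zero_le_power2)
    then show ?thesis by (auto simp: P zero_less_mult_iff)
  qed
  have mm: "(A ** B) $ i $ j = A$i$1 * B$1$j + A$i$2 * B$2$j" for A B :: "real^2^2" and i j
    by (simp add: matrix_matrix_mult_def sum_2)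
  show ?thesis
  proof (cases "b = 0")
    case True
    define D where "D = (\<lambda>i::2. if i = 1 then a else c)"
    have "P ** mat 1 = mat 1 ** (\<chi> i j. if i = j then D i else 0)"
      by (simp add: vec_eq_iff forall_2 P True D_def)
    moreover have "card {i. D i < 0} = (if det P < 0 then 1 else if P $ 1 $ 1 > 0 then 0 else 2)"
      using count[of D a c] det sgn by (simp add: D_def dP True)
    ultimately show ?thesis by (intro exI[of _ "mat 1"] exI[of _ D]) simp
  next
    case False
    define s where "s = sqrt ((a - c)\<^sup>2 + 4 * b\<^sup>2)"
    have s2: "s * s = (a - c) * (a - c) + 4 * (b * b)"
      by (simp add: s_def flip: power2_eq_square)
    have s: "s > 0" unfolding s_def using False by (simp add: add_nonneg_pos)
    define D where "D = (\<lambda>i::2. if i = 1 then (a + c + s) / 2 else (a + c - s) / 2)"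
    \<comment> \<open>Column \<open>j\<close> is the unnormalized eigenvector
      \<open>(b, D j - a)\<close>. It solves the first row of the eigenvalue equation identically,
      and the second row is the characteristic equation \<open>ch\<close>. Since it could vanish for
      \<open>b = 0\<close>, that case is separate.\<close>
    define U :: "real^2^2" where "U = (\<chi> i j. if i = 1 then b else D j - a)"
    have "D 1 * D 2 = ((a + c)\<^sup>2 - s * s) / 4" by (simp add: D_def power2_eq_square field_simps)
    then have DD: "D 1 * D 2 = det P" unfolding s2 dP by (simp add: power2_eq_square field_simps)
    have "det U = - b * s" by (simp add: det_2 U_def D_def field_simps)
    then have "det U \<noteq> 0" using False s by simp
    moreover have "P ** U = U ** (\<chi> i j. if i = j then D i else 0)"
    proof -
      have ch: "b * b + c * (D j - a) = (D j - a) * D j" for j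
      proof -
        obtain e where e: "D j = (a + c + e) / 2" "e * e = s * s"
          by (cases "j = 1") (auto simp: D_def intro: that[of s] that[of "- s"])
        have "(D j - a) * (D j - c) = (e * e - (a - c) * (a - c)) / 4"
          unfolding e(1) by (simp add: field_simps)
        also have "\<dots> = b * b" by (simp add: e(2) s2)
        finally show ?thesis by (simp add: algebra_simps)
      qed
      show ?thesis using ch[of 1] ch[of 2]
        by (simp add: vec_eq_iff forall_2 mm P U_def algebra_simps)
    qed
    moreover have "card {i. D i < 0} = (if det P < 0 then 1 else if P $ 1 $ 1 > 0 then 0 else 2)"
    proof -
      have "D 1 + D 2 = a + c" by (simp add: D_def add_divide_distrib diff_divide_distrib)
      then show ?thesis using count[of D "D 1" "D 2"] DD det sgn by simp
    qed
    ultimately show ?thesis by blast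
  qed
qed

section \<open>Traces in number fields\<close>

text \<open>For an integer polynomial \<open>p\<close> of degree \<open>d\<close> with leading
  coefficient \<open>a\<close>, the value \<open>a ^ (d - 1) * poly p x\<close> is a monic integer
  polynomial in \<open>a * x\<close>, namely \<open>q\<close>. The degree is nonzero because
  \<open>p\<close> has a root, which keeps \<open>d - 1\<close> from being truncated.\<close>

lemma algebraic_imp_algebraic_int_multiple:
  fixes x :: "'f::field_char_0"
  assumes "algebraic x"
  shows "\<exists>m::int. m \<noteq> 0 \<and> algebraic_int (of_int m * x)"
proof -
  obtain p where p: "\<And>i. coeff p i \<in> \<int>" "p \<noteq> 0" "poly p x = 0"
    using assms by (auto simp: algebraic_def)
  define d where "d = degree p"
  have "\<forall>i. \<exists>k. coeff p i = of_int k" using p(1) by (meson Ints_cases)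
  then obtain c where c: "\<And>i. coeff p i = of_int (c i)" by metis
  define a where "a = c d"
  have a: "a \<noteq> 0" using p(2) c[of d] by (auto simp: a_def d_def)
  have d: "d \<noteq> 0"
  proof
    assume "d = 0"
    then obtain k where "p = [:k:]" using degree_eq_zeroE d_def by metis
    then show False using p by simp
  qed
  define q :: "'f poly" where "q = monom 1 d + (\<Sum>i<d. monom (of_int (c i * a ^ (d - 1 - i))) i)"
  have cq: "coeff q i = (if i = d then 1 else if i < d then of_int (c i * a ^ (d - 1 - i)) else 0)" for i
    by (simp add: q_def coeff_sum coeff_monom)
  have "degree q = d"
    by (rule antisym) (auto intro!: degree_le le_degree simp: cq)
  then have lq: "lead_coeff q = 1" by (simp add: cq)
  have "poly q (of_int a * x) = of_int a ^ (d - 1) * poly p x"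
  proof -
    have e: "of_int a ^ d = of_int a ^ (d - 1) * (of_int a :: 'f)" using d by (cases d) auto
    have "poly q (of_int a * x) = of_int a ^ d * x ^ d
        + (\<Sum>i<d. of_int (c i * a ^ (d - 1 - i)) * (of_int a * x) ^ i)"
      by (simp add: q_def poly_monom poly_sum power_mult_distrib)
    also have "(\<Sum>i<d. of_int (c i * a ^ (d - 1 - i)) * (of_int a * x) ^ i)
        = (\<Sum>i<d. of_int a ^ (d - 1) * (of_int (c i) * x ^ i))"
    proof (rule sum.cong)
      fix i assume "i \<in> {..<d}"
      then have "(of_int a :: 'f) ^ (d - 1) = of_int a ^ (d - 1 - i) * of_int a ^ i"
        by (simp flip: power_add)
      then show "of_int (c i * a ^ (d - 1 - i)) * (of_int a * x) ^ i
          = of_int a ^ (d - 1) * (of_int (c i) * x ^ i)"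
        by (simp add: power_mult_distrib)
    qed simp
    also have "of_int a ^ d * x ^ d = of_int a ^ (d - 1) * (of_int (c d) * x ^ d)"
      by (simp only: e a_def[symmetric] mult.assoc)
    finally have "poly q (of_int a * x) = of_int a ^ (d - 1) * ((\<Sum>i<d. of_int (c i) * x ^ i) + of_int (c d) * x ^ d)"
      by (simp add: distrib_left sum_distrib_left)
    also have "(\<Sum>i<d. of_int (c i) * x ^ i) + of_int (c d) * x ^ d = poly p x"
      by (simp add: poly_altdef c d_def lessThan_Suc_atMost[symmetric])
    finally show ?thesis .
  qed
  then have "algebraic_int (of_int a * x)"
    by (intro algebraic_int.intros[of q]) (use lq p(3) in \<open>auto simp: cq\<close>)
  with a show ?thesis by blast
qed

lemma finite_extension_imp_algebraic:
  fixes x :: "'f::field_char_0"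
  assumes S: "finite S" "module.span (\<lambda>q x. of_rat q * x) S = (UNIV :: 'f set)"
  shows "algebraic x"
proof -
  interpret vector_space "\<lambda>q x. of_rat q * (x :: 'f)"
    by unfold_locales (simp_all add: algebra_simps of_rat_add of_rat_mult)
  let ?P = "range (\<lambda>k::nat. x ^ k)"
  show ?thesis
  \<comment> \<open>Dependence is a property of the set of powers and does not see repetitions. If
    \<open>x ^ j = x ^ k\<close> with \<open>j \<noteq> k\<close>, then \<open>x\<close> is a root
    of \<open>X^j - X^k\<close>; otherwise the set is infinite and hence dependent.\<close>
  proof (cases "inj (\<lambda>k::nat. x ^ k)")
    case False
    then obtain j k :: nat where jk: "j \<noteq> k" "x ^ j = x ^ k" by (auto simp: inj_def)
    show ?thesis
    proof (rule algebraicI)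
      show "monom 1 j - monom 1 k \<noteq> (0 :: 'f poly)"
        using jk(1) by (metis coeff_diff coeff_0 coeff_monom diff_zero zero_neq_one)
    qed (use jk in \<open>auto simp: poly_monom coeff_monom\<close>)
  next
    case True
    then have "infinite ?P" using finite_imageD infinite_UNIV_nat by blast
    then have "dependent ?P" using independent_span_bound[OF S(1)] S(2) by blast
    then obtain t u v where t: "finite t" "t \<subseteq> ?P" "v \<in> t" "u v \<noteq> (0::rat)"
        "(\<Sum>v\<in>t. of_rat (u v) * v) = 0"
      unfolding dependent_explicit by auto
    define K where "K = {k. x ^ k \<in> t}"
    have tK: "t = (\<lambda>k. x ^ k) ` K" using t(2) by (auto simp: K_def)
    have fK: "finite K" using t(1) unfolding tK by (rule finite_imageD) (use True in \<open>auto simp: inj_on_def inj_def\<close>)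
    define p :: "'f poly" where "p = (\<Sum>k\<in>K. monom (of_rat (u (x ^ k))) k)"
    have cp: "coeff p i = (if i \<in> K then of_rat (u (x ^ i)) else 0)" for i
      using fK by (simp add: p_def coeff_sum coeff_monom)
    obtain k where k: "v = x ^ k" "k \<in> K" using t(3) tK by auto
    show ?thesis
    proof (rule algebraicI')
      show "coeff p i \<in> \<rat>" for i by (simp add: cp)
      show "p \<noteq> 0" using cp[of k] k t(4) by auto
      have "poly p x = (\<Sum>k\<in>K. of_rat (u (x ^ k)) * x ^ k)"
        by (simp add: p_def poly_sum poly_monom)
      also have "\<dots> = (\<Sum>v\<in>t. of_rat (u v) * v)"
        unfolding tK by (rule sum.reindex_cong[symmetric, of "\<lambda>k. x ^ k"]) (use True in \<open>auto simp: inj_on_def inj_def\<close>)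
      finally show "poly p x = 0" using t(5) by simp
    qed
  qed
qed

section \<open>Real embeddings of a number field and rationality of the trace\<close>

locale number_field_embeddings =
  fixes emb :: "'n::finite \<Rightarrow> 'f::field_char_0 \<Rightarrow> real"
  assumes degree: "field_degree TYPE('f) = CARD('n)"
    and emb: "bij_betw emb UNIV real_embeddings"
begin

lemma emb_hom: "is_ring_hom (emb p)"
  using emb by (auto simp: bij_betw_def real_embeddings_def)

lemma emb_add [simp]: "emb p (x + y) = emb p x + emb p y"
  and emb_mult [simp]: "emb p (x * y) = emb p x * emb p y"
  and emb_1 [simp]: "emb p 1 = 1"
  using emb_hom[of p] by (auto simp: is_ring_hom_def)

lemma emb_0 [simp]: "emb p 0 = 0"
  using emb_add[of p 0 0] by simp

lemma emb_minus [simp]: "emb p (- x) = - emb p x"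
  using emb_add[of p x "- x"] by simp

lemma emb_diff [simp]: "emb p (x - y) = emb p x - emb p y"
  using emb_add[of p "x - y" y] by simp

lemma emb_eq_0_iff [simp]: "emb p x = 0 \<longleftrightarrow> x = 0"
proof
  assume "emb p x = 0"
  then show "x = 0" using emb_mult[of p x "inverse x"] by (cases "x = 0") auto
qed simp

lemma emb_sum: "emb p (sum f A) = (\<Sum>a\<in>A. emb p (f a))"
  by (induction A rule: infinite_finite_induct) auto

lemma emb_of_nat [simp]: "emb p (of_nat k) = of_nat k"
  by (induction k) auto

lemma emb_of_int [simp]: "emb p (of_int k) = of_int k"
  by (cases k) auto

lemma emb_of_rat [simp]: "emb p (of_rat q) = of_rat q"
proof (cases q)
  case (Fract a b)
  then have "(of_rat q :: 'f) * of_int b = of_int a" by (simp add: of_rat_rat)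
  then have "emb p (of_rat q) * of_int b = of_int a" by (metis emb_mult emb_of_int)
  with Fract show ?thesis by (simp add: of_rat_rat field_simps)
qed

lemma emb_indep:
  assumes "\<And>x. (\<Sum>p\<in>UNIV. c p * emb p x) = 0"
  shows "c p = 0"
proof -
  have inj: "inj emb" using emb by (auto simp: bij_betw_def)
  have "\<forall>\<sigma>\<in>range emb. c (inv emb \<sigma>) = 0"
    by (rule ring_hom_independence) (use assms inj in \<open>auto simp: emb_hom sum.reindex\<close>)
  then show ?thesis using inj by simp
qed

lemma emb_separates: "p \<noteq> q \<Longrightarrow> \<exists>x. emb p x \<noteq> emb q x"
  using emb by (metis bij_betw_imp_inj_on ext injD)

lemma sum_real_embeddings: "(\<Sum>\<sigma>\<in>real_embeddings. f \<sigma>) = (\<Sum>p\<in>UNIV. f (emb p))"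
  using emb sum.reindex_bij_betw by metis

sublocale rat_field: vector_space "\<lambda>q x. of_rat q * (x :: 'f)"
  by unfold_locales (simp_all add: algebra_simps of_rat_add of_rat_mult)

lemma rational_basis:
  obtains B where "finite B" "card B = CARD('n)" "\<not> rat_field.dependent B" "rat_field.span B = UNIV"
proof -
  obtain B where B: "\<not> rat_field.dependent B" "UNIV \<subseteq> rat_field.span B"
      "card B = rat_field.dim UNIV"
    using rat_field.basis_exists[of UNIV] by metis
  have "card B = CARD('n)" using B(3) degree by (simp add: field_degree_def)
  \<comment> \<open>An infinite set would have \<open>card\<close> 0, whereas
    \<open>CARD('n)\<close> is positive.\<close>
  moreover from this have "finite B" by (metis card.infinite zero_less_card_finite less_irrefl)
  ultimately show ?thesis using B that by blast
qed

lemma algebraic_int_multiple: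
  fixes x :: 'f
  shows "\<exists>m::int. m \<noteq> 0 \<and> algebraic_int (of_int m * x)"
  by (metis rational_basis finite_extension_imp_algebraic algebraic_imp_algebraic_int_multiple)

text \<open>The matrix \<open>A\<close> of all embeddings of a basis conjugates multiplication by
  \<open>x\<close>, whose matrix \<open>M\<close> in that basis is rational, into the diagonal
  matrix of the conjugates of \<open>x\<close>. It is square because there are as many real
  embeddings as the degree.\<close>

lemma field_trace_rational: "field_trace (x :: 'f) \<in> \<rat>"
proof -
  obtain B where B: "finite B" "card B = CARD('n)" "\<not> rat_field.dependent B" "rat_field.span B = UNIV"
    by (rule rational_basis)
  obtain b where b: "bij_betw b (UNIV :: 'n set) B"
    using B finite_same_card_bij by (metis finite)
  have ex: "\<exists>c :: 'n \<Rightarrow> rat. y = (\<Sum>j\<in>UNIV. of_rat (c j) * b j)" for y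
  proof -
    have "y \<in> rat_field.span B" using B by simp
    then obtain u where "y = (\<Sum>v\<in>B. of_rat (u v) * v)"
      unfolding rat_field.span_finite[OF B(1)] by auto
    also have "\<dots> = (\<Sum>j\<in>UNIV. of_rat (u (b j)) * b j)"
      using sum.reindex_bij_betw[OF b, of "\<lambda>v. of_rat (u v) * v"] by simp
    finally show ?thesis by (intro exI[of _ "\<lambda>j. u (b j)"])
  qed
  then have "\<forall>j. \<exists>c. x * b j = (\<Sum>k\<in>UNIV. of_rat (c k) * b k)" by blast
  then obtain m where m: "\<And>j. x * b j = (\<Sum>k\<in>UNIV. of_rat (m j k) * b k)" by metis
  define A :: "real^'n^'n" where "A = (\<chi> j p. emb p (b j))"
  define M :: "real^'n^'n" where "M = (\<chi> j k. of_rat (m j k))"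
  define D :: "real^'n^'n" where "D = (\<chi> p q. if p = q then emb p x else 0)"
  have "M ** A = A ** D"
  proof -
    have "(M ** A) $ j $ p = (A ** D) $ j $ p" for j p
    proof -
      have "(M ** A) $ j $ p = emb p (\<Sum>k\<in>UNIV. of_rat (m j k) * b k)"
        by (simp add: matrix_matrix_mult_def M_def A_def emb_sum)
      also have "\<dots> = emb p (x * b j)" by (simp only: m)
      finally show ?thesis
        by (simp add: matrix_matrix_mult_def A_def D_def if_distrib[of "\<lambda>x. _ * x"] mult.commute cong: if_cong)
    qed
    then show ?thesis by (simp add: vec_eq_iff)
  qed
  \<comment> \<open>A kernel vector of \<open>A\<close> is a linear relation between the embeddings
    on the basis, hence on the whole field, against their independence.\<close>
  moreover have "invertible A"
  proof -
    have "c = 0" if c: "A *v c = 0" for c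
    proof -
      have z: "(\<Sum>p\<in>UNIV. c $ p * emb p (b j)) = 0" for j
        using c by (simp add: vec_eq_iff matrix_vector_mult_def A_def mult.commute)
      have "(\<Sum>p\<in>UNIV. c $ p * emb p y) = 0" for y
      proof -
        obtain u where u: "y = (\<Sum>j\<in>UNIV. of_rat (u j) * b j)" using ex by blast
        have "(\<Sum>p\<in>UNIV. c $ p * emb p y) = (\<Sum>p\<in>UNIV. \<Sum>j\<in>UNIV. of_rat (u j) * (c $ p * emb p (b j)))"
          by (simp add: u emb_sum sum_distrib_left mult_ac)
        also have "\<dots> = (\<Sum>j\<in>UNIV. of_rat (u j) * (\<Sum>p\<in>UNIV. c $ p * emb p (b j)))"
          by (subst sum.swap) (simp add: sum_distrib_left)
        finally show ?thesis by (simp add: z)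
      qed
      then show "c = 0" using emb_indep[of "\<lambda>p. c $ p"] by (simp add: vec_eq_iff)
    qed
    then have "\<exists>B. B ** A = mat 1" using matrix_left_invertible_ker by blast
    then show ?thesis using invertible_left_inverse by blast
  qed
  then obtain A' where "A' ** A = mat 1" "A ** A' = mat 1" by (auto simp: invertible_def)
  ultimately have "D = A' ** (M ** A)" by (metis matrix_mul_assoc matrix_mul_lid)
  then have "trace D = trace M"
    using \<open>A ** A' = mat 1\<close> by (metis matrix_mul_assoc matrix_mul_rid trace_mul_sym)
  moreover have "trace D = field_trace x"
    by (simp add: trace_def D_def field_trace_def sum_real_embeddings)
  moreover have "trace M \<in> \<rat>" by (auto simp: trace_def M_def)
  ultimately show ?thesis by simp
qed

end

section \<open>The reduced trace\<close>

lemma cayley_hamilton_2x2: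
  fixes A :: "real^2^2"
  shows "A ** A = trace A *\<^sub>R A - det A *\<^sub>R mat 1"
  by (simp add: vec_eq_iff forall_2 matrix_matrix_mult_def sum_2 trace_def det_2 mat_def algebra_simps)

lemma mat_eq_scaleR: "mat a = a *\<^sub>R (mat 1 :: real^'n^'n)"
  by (simp add: vec_eq_iff mat_def)

lemma trace_scaleR: "trace (a *\<^sub>R A) = a * trace (A :: real^'n^'n)"
  by (simp add: trace_def sum_distrib_left)

locale split_quaternion_algebra = number_field_embeddings emb
  for emb :: "'n::finite \<Rightarrow> 'f::field_char_0 \<Rightarrow> real" +
  fixes \<iota> :: "'f \<Rightarrow> 'b::division_ring" and \<rho> :: "('f \<Rightarrow> real) \<Rightarrow> 'b \<Rightarrow> real^2^2"
  assumes quat: "quaternion_algebra \<iota>"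
    and split: "\<And>p. splitting \<iota> (emb p) (\<rho> (emb p))"
begin

abbreviation "r p \<equiv> \<rho> (emb p)"

lemma r_1 [simp]: "r p 1 = mat 1"
  and r_add: "r p (x + y) = r p x + r p y"
  and r_mult: "r p (x * y) = r p x ** r p y"
  and r_central [simp]: "r p (\<iota> a) = mat (emb p a)"
  using split[of p] by (auto simp: splitting_def)

lemma r_0 [simp]: "r p 0 = 0"
  using r_add[of p 0 0] by simp

lemma r_minus: "r p (- x) = - r p x"
  using r_add[of p x "- x"] by (simp add: eq_neg_iff_add_eq_0 add.commute)

lemma r_diff: "r p (x - y) = r p x - r p y"
  using r_add[of p x "- y"] r_minus[of p y] by simp

lemma r_scale: "r p (\<iota> a * x) = emb p a *\<^sub>R r p x"
  by (simp add: r_mult mat_eq_scaleR[of "emb p a"] flip: scalar_matrix_assoc)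

lemma \<iota>_1 [simp]: "\<iota> 1 = 1"
  and \<iota>_add: "\<iota> (a + b) = \<iota> a + \<iota> b"
  and \<iota>_mult: "\<iota> (a * b) = \<iota> a * \<iota> b"
  using quat by (auto simp: quaternion_algebra_def is_ring_hom_def)

lemma \<iota>_0 [simp]: "\<iota> 0 = 0"
  using \<iota>_add[of 0 0] by simp

lemma \<iota>_minus: "\<iota> (- a) = - \<iota> a"
  using \<iota>_add[of a "- a"] by (simp add: eq_neg_iff_add_eq_0 add.commute)

lemma \<iota>_diff: "\<iota> (a - b) = \<iota> a - \<iota> b"
  using \<iota>_add[of a "- b"] \<iota>_minus[of b] by simp

lemma \<iota>_of_nat: "\<iota> (of_nat k) = of_nat k"
  by (induction k) (auto simp: \<iota>_add)

lemma \<iota>_eq_0_iff [simp]: "\<iota> a = 0 \<longleftrightarrow> a = 0"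
proof
  assume "\<iota> a = 0"
  then show "a = 0" using \<iota>_mult[of a "inverse a"] by (cases "a = 0") auto
qed simp

lemma \<iota>_eq_iff [simp]: "\<iota> a = \<iota> b \<longleftrightarrow> a = b"
  using \<iota>_eq_0_iff[of "a - b"] by (auto simp: \<iota>_diff)

lemma r_eq_0_iff [simp]: "r p x = 0 \<longleftrightarrow> x = 0"
proof
  assume "r p x = 0"
  show "x = 0"
  proof (rule ccontr)
    assume "x \<noteq> 0"
    then have "r p x ** r p (inverse x) = mat 1" by (simp flip: r_mult)
    then show False using \<open>r p x = 0\<close> by (simp add: vec_eq_iff mat_def forall_2)
  qed
qed simp

lemma r_eq_iff [simp]: "r p x = r p y \<longleftrightarrow> x = y"
  using r_eq_0_iff[of p "x - y"] by (auto simp: r_diff)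

sublocale F: vector_space "\<lambda>a x. \<iota> a * x"
  by unfold_locales (simp_all add: algebra_simps \<iota>_add \<iota>_mult)

sublocale Q: vector_space "\<lambda>q x. \<iota> (of_rat q) * x"
  by unfold_locales (simp_all add: distrib_left distrib_right \<iota>_add of_rat_add of_rat_mult)

lemma field_basis:
  obtains S where "finite S" "\<not> F.dependent S" "F.span S = UNIV"
proof -
  obtain B where B: "\<not> F.dependent B" "UNIV \<subseteq> F.span B" "card B = F.dim UNIV"
    using F.basis_exists[of UNIV] by metis
  have "card B = 4" using B(3) quat by (simp add: quaternion_algebra_def)
  then have "finite B" using card.infinite by fastforce
  with B that show ?thesis by blast
qed

section \<open>Finite spanning sets, and relations carried back from real matrices\<close>

lemma rational_span:
  obtains S where "finite S" "Q.span S = UNIV"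
proof -
  obtain A where A: "finite A" "rat_field.span A = UNIV" by (rule rational_basis)
  obtain S where S: "finite S" "F.span S = UNIV" by (rule field_basis)
  define T where "T = (\<lambda>(a, s). \<iota> a * s) ` (A \<times> S)"
  have "\<iota> c * s \<in> Q.span T" if s: "s \<in> S" for c s
  proof -
    have "c \<in> rat_field.span A" using A by simp
    then show ?thesis
    proof (induction rule: rat_field.span_induct_alt)
      case (step q a y)
      have "\<iota> a * s \<in> Q.span T" using step s by (auto intro!: Q.span_base simp: T_def)
      then have "\<iota> (of_rat q) * (\<iota> a * s) \<in> Q.span T" by (rule Q.span_scale)
      then show ?case using step by (simp add: \<iota>_add distrib_right Q.span_add)
    qed (simp add: Q.span_zero)
  qed
  moreover have "x \<in> F.span S" for x using S by simp
  then have "\<exists>u. x = (\<Sum>v\<in>S. \<iota> (u v) * v)" for x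
    using F.span_finite[OF S(1)] by (metis (no_types, lifting) imageE)
  ultimately have "x \<in> Q.span T" for x
    using Q.span_sum by (metis (no_types, lifting))
  moreover have "finite T" using A S by (simp add: T_def)
  ultimately show ?thesis using that by blast
qed

text \<open>\<open>splitting\<close> speaks only about bases over the field, so an independent set
  is first extended to one.\<close>

lemma r_independent:
  assumes "\<not> F.dependent S"
  shows "inj_on (r p) S" "independent (r p ` S)"
proof -
  obtain B where B: "S \<subseteq> B" "\<not> F.dependent B" "F.span B = UNIV"
    using F.maximal_independent_subset_extend[OF subset_UNIV assms] by (metis top.extremum_uniqueI)
  then have "inj_on (r p) B" "independent (r p ` B)"
    using split[of p] by (auto simp: splitting_def)
  then show "inj_on (r p) S" "independent (r p ` S)"
    using inj_on_subset[OF _ B(1)] independent_mono[OF _ image_mono[OF B(1)]] by simp_all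
qed

lemma span_range_r: "span (range (r p)) = UNIV"
proof -
  obtain S where "finite S" "\<not> F.dependent S" "F.span S = UNIV" by (rule field_basis)
  then have "span (r p ` S) = UNIV" using split[of p] by (auto simp: splitting_def)
  then show ?thesis using span_mono[of "r p ` S" "range (r p)"] by auto
qed

text \<open>The means of descent: the real coefficients of a relation between the matrices need not
  come from the field, but by \<open>r_independent\<close> its existence already forces some
  relation with coefficients in the field.\<close>

lemma r_dependent_imp:
  assumes "(\<Sum>v\<in>S. c v *\<^sub>R r p v) = 0" "finite S" "v \<in> S" "c v \<noteq> 0"
  shows "F.dependent S"
proof (rule ccontr)
  assume "\<not> F.dependent S"
  note ind = r_independent[OF this, of p]
  have "(\<Sum>w\<in>r p ` S. c (inv_into S (r p) w) *\<^sub>R w) = 0"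
    using assms(1) ind(1) by (subst sum.reindex) simp_all
  then have "c (inv_into S (r p) (r p v)) = 0"
    using independentD[OF ind(2), of "r p ` S" "\<lambda>w. c (inv_into S (r p) w)" "r p v"] assms by auto
  then show False using assms ind(1) by simp
qed

text \<open>Cayley-Hamilton gives a real relation between the images of \<open>1\<close>,
  \<open>x\<close> and \<open>x * x\<close>, which descends to the field. Its coefficient at
  \<open>x * x\<close> cannot vanish for noncentral \<open>x\<close>, so it can be
  normalized.\<close>

lemma quaternion_quadratic:
  assumes x: "x \<notin> range \<iota>"
  shows "\<exists>t m. x * x - \<iota> t * x + \<iota> m = 0"
proof -
  obtain p :: 'n where True by blast
  have x1: "x \<noteq> 1" using x \<iota>_1 by (metis rangeI)
  \<comment> \<open>Relations are indexed by the elements of a set, so the three vectors have to be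
    distinct.\<close>
  have xx: "x * x \<noteq> x" "x * x \<noteq> 1"
  proof -
    show "x * x \<noteq> x"
      using x1 x \<iota>_0 by (metis mult_cancel_left1 rangeI)
    show "x * x \<noteq> 1"
    proof
      assume "x * x = 1"
      then have "(x - 1) * (x + 1) = 0" by (simp add: algebra_simps)
      then have "x = \<iota> 1 \<or> x = \<iota> (- 1)" by (auto simp: \<iota>_minus eq_neg_iff_add_eq_0)
      then show False using x by blast
    qed
  qed
  let ?S = "{1, x, x * x}"
  define c where "c = (\<lambda>v. if v = 1 then det (r p x) else if v = x then - trace (r p x) else 1)"
  have "(\<Sum>v\<in>?S. c v *\<^sub>R r p v) = 0"
    using x1 xx by (simp add: c_def r_mult cayley_hamilton_2x2)
  then have "F.dependent ?S"
    by (rule r_dependent_imp[where v = "x * x"]) (use x1 xx in \<open>auto simp: c_def\<close>)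
  then obtain u where u: "\<exists>v\<in>?S. u v \<noteq> 0" "(\<Sum>v\<in>?S. \<iota> (u v) * v) = 0"
    unfolding F.dependent_finite[of ?S, simplified] by auto
  have eq: "\<iota> (u 1) + \<iota> (u x) * x + \<iota> (u (x * x)) * (x * x) = 0"
    using u(2) x1 xx by (simp add: add.assoc)
  have "u (x * x) \<noteq> 0"
  proof
    assume 0: "u (x * x) = 0"
    then have 1: "\<iota> (u 1) + \<iota> (u x) * x = 0" using eq by simp
    show False
    proof (cases "u x = 0")
      case True then show False using 0 1 u(1) by auto
    next
      case False
      have "\<iota> (u x) * x = \<iota> (- u 1)" using 1 by (simp add: \<iota>_minus eq_neg_iff_add_eq_0 add.commute)
      then have "\<iota> (inverse (u x)) * (\<iota> (u x) * x) = \<iota> (inverse (u x) * - u 1)"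
        by (simp only: \<iota>_mult)
      also have "\<iota> (inverse (u x)) * (\<iota> (u x) * x) = x"
        using False by (simp flip: mult.assoc \<iota>_mult)
      finally show False using x by blast
    qed
  qed
  define k where "k = inverse (u (x * x))"
  have "\<iota> k * (\<iota> (u 1) + \<iota> (u x) * x + \<iota> (u (x * x)) * (x * x)) = 0"
    unfolding eq by simp
  then have "\<iota> (k * u 1) + \<iota> (k * u x) * x + \<iota> (k * u (x * x)) * (x * x) = 0"
    by (simp only: distrib_left \<iota>_mult mult.assoc)
  moreover have "k * u (x * x) = 1" using \<open>u (x * x) \<noteq> 0\<close> by (simp add: k_def)
  ultimately have "x * x - \<iota> (- (k * u x)) * x + \<iota> (k * u 1) = 0"
    by (simp add: \<iota>_minus algebra_simps)
  then show ?thesis by blast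
qed

text \<open>Two equations with different \<open>t\<close> could be subtracted and solved for
  \<open>x\<close> in the centre. This leaves the \<open>THE\<close> of \<open>reduced_trace\<close>
  a single candidate.\<close>

lemma quadratic_unique:
  assumes x: "x \<notin> range \<iota>" and "x * x - \<iota> t * x + \<iota> m = 0" "x * x - \<iota> t' * x + \<iota> m' = 0"
  shows "t = t'"
proof (rule ccontr)
  assume "t \<noteq> t'"
  have "\<iota> (t - t') * x = \<iota> (m - m')"
    using assms(2,3) by (simp add: \<iota>_diff algebra_simps) (metis add_diff_cancel_left' add_diff_eq)
  then have "\<iota> (inverse (t - t')) * (\<iota> (t - t') * x) = \<iota> (inverse (t - t') * (m - m'))"
    by (simp only: \<iota>_mult)
  also have "\<iota> (inverse (t - t')) * (\<iota> (t - t') * x) = x"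
    using \<open>t \<noteq> t'\<close> by (simp flip: mult.assoc \<iota>_mult)
  finally show False using x by blast
qed

text \<open>The matrix \<open>r p x\<close> satisfies both the image of the quadratic equation of
  \<open>x\<close> and its own characteristic equation. If their linear coefficients differed,
  \<open>r p x\<close> would be a scalar matrix, and descent would make \<open>x\<close>
  central.\<close>

lemma emb_reduced_trace: "emb p (reduced_trace \<iota> x) = trace (r p x)"
proof (cases "x \<in> range \<iota>")
  case True
  then obtain a where a: "x = \<iota> a" by blast
  then have "reduced_trace \<iota> x = 2 * a" by (simp add: reduced_trace_def)
  moreover have "emb p 2 = 2" using emb_of_nat[of p 2] by simp
  ultimately show ?thesis by (simp add: a trace_def mat_def sum_2)
next
  case False
  obtain t m where tm: "x * x - \<iota> t * x + \<iota> m = 0" using quaternion_quadratic[OF False] by blast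
  have "reduced_trace \<iota> x = t"
    unfolding reduced_trace_def using False tm quadratic_unique[OF False] by (auto intro!: the_equality)
  have "r p (x * x - \<iota> t * x + \<iota> m) = 0" by (simp add: tm)
  then have 1: "r p x ** r p x = emb p t *\<^sub>R r p x - emb p m *\<^sub>R mat 1"
    by (simp add: r_add r_diff r_scale mat_eq_scaleR[of "emb p m"] r_mult[of p x x] algebra_simps)
  have 2: "(trace (r p x) - emb p t) *\<^sub>R r p x = (det (r p x) - emb p m) *\<^sub>R mat 1"
    using 1 unfolding cayley_hamilton_2x2 by (simp add: algebra_simps)
  have "trace (r p x) = emb p t"
  proof (rule ccontr)
    assume ne: "trace (r p x) \<noteq> emb p t"
    have x1: "x \<noteq> 1" using False \<iota>_1 by (metis rangeI)
    have "F.dependent {1, x}"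
      by (rule r_dependent_imp[where v = x and p = p and
          c = "\<lambda>v. if v = x then trace (r p x) - emb p t else - (det (r p x) - emb p m)"])
        (use x1 ne 2 in \<open>auto simp flip: scaleR_left_distrib\<close>)
    then have "x \<in> F.span {1}" using F.independent_insert[of x "{1}"] x1 by (auto simp: insert_commute)
    then show False using False by (auto simp: F.span_singleton)
  qed
  then show ?thesis using \<open>reduced_trace \<iota> x = t\<close> by simp
qed

lemma quaternion_trace_eq: "quaternion_trace \<iota> x = (\<Sum>p\<in>UNIV. trace (r p x))"
  by (simp add: quaternion_trace_def field_trace_def sum_real_embeddings emb_reduced_trace)

lemma quaternion_trace_rational: "quaternion_trace \<iota> x \<in> \<rat>"
  by (simp add: quaternion_trace_def field_trace_rational)

text \<open>Replacing \<open>b\<close> by \<open>\<iota> a * b\<close> multiplies the summand of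
  \<open>p\<close> by \<open>emb p a\<close>, so independence of the embeddings isolates each
  summand. The matrices \<open>r p b\<close> span, and testing against the transpose of
  \<open>X p\<close> gives a sum of squares.\<close>

lemma trace_form_nondegenerate:
  assumes "\<And>b. (\<Sum>p\<in>UNIV. trace (X p ** r p b)) = 0"
  shows "X p = (0 :: real^2^2)"
proof -
  have tr: "trace (X p ** r p b) = 0" for b
  proof (rule emb_indep)
    fix a
    have "(\<Sum>p\<in>UNIV. trace (X p ** r p b) * emb p a) = (\<Sum>p\<in>UNIV. trace (X p ** r p (\<iota> a * b)))"
      by (simp add: r_scale trace_scaleR matrix_scalar_ac mult.commute flip: scalar_matrix_assoc)
    then show "(\<Sum>p\<in>UNIV. trace (X p ** r p b) * emb p a) = 0" using assms by simp
  qed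
  have "trace (X p ** M) = 0" for M
  proof -
    have "M \<in> span (range (r p))" by (simp add: span_range_r)
    then show ?thesis
    proof (induction rule: span_induct_alt)
      case (step c x y)
      then have "trace (X p ** x) = 0" using tr by auto
      then show ?case using step by (simp add: matrix_add_ldistrib trace_add matrix_scalar_ac trace_scaleR flip: scalar_matrix_assoc)
    qed (simp add: trace_def)
  qed
  from this[of "transpose (X p)"] have "(\<Sum>i\<in>UNIV. \<Sum>j\<in>UNIV. (X p $ i $ j)\<^sup>2) = 0"
    by (simp add: trace_def matrix_matrix_mult_def transpose_def power2_eq_square)
  then show ?thesis by (simp add: sum_nonneg_eq_0_iff sum_nonneg vec_eq_iff)
qed

text \<open>Solving over the rationals finds the representing element in the algebra itself, not
  merely in a real scalar extension. The inverse images \<open>h\<close> and \<open>k\<close> turn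
  real values known to be rational into values of type \<open>rat\<close>, over which the algebra is
  finite-dimensional.\<close>

lemma rational_form_represents:
  fixes f :: "'b \<Rightarrow> 'b \<Rightarrow> real" and g :: "'b \<Rightarrow> real"
  assumes rat: "\<And>x y. f x y \<in> \<rat>" "\<And>x. g x \<in> \<rat>"
    and add: "\<And>x x' y. f (x + x') y = f x y + f x' y" "\<And>x y y'. f x (y + y') = f x y + f x y'"
      "\<And>x y. g (x + y) = g x + g y"
    and scale: "\<And>q x y. f (\<iota> (of_rat q) * x) y = of_rat q * f x y"
      "\<And>q x y. f x (\<iota> (of_rat q) * y) = of_rat q * f x y"
      "\<And>q x. g (\<iota> (of_rat q) * x) = of_rat q * g x"
    and nondeg: "\<And>x. (\<And>y. f x y = 0) \<Longrightarrow> x = 0"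
  shows "\<exists>x. \<forall>y. g y = f x y"
proof -
  define h where "h = (\<lambda>x y. inv of_rat (f x y) :: rat)"
  define k where "k = (\<lambda>x. inv of_rat (g x) :: rat)"
  have h: "of_rat (h x y) = f x y" for x y
    unfolding h_def using rat(1)[of x y] by (auto simp: Rats_def intro!: f_inv_into_f)
  have k: "of_rat (k x) = g x" for x
    unfolding k_def using rat(2)[of x] by (auto simp: Rats_def intro!: f_inv_into_f)
  have inj: "q = q'" if "(of_rat q :: real) = of_rat q'" for q q' using that by simp
  have vs: "vector_space ((*) :: rat \<Rightarrow> _)" by unfold_locales (auto simp: algebra_simps)
  obtain S where "finite S" "Q.span S = UNIV" by (rule rational_span)
  then have "\<exists>x. \<forall>y. k y = h x y"
  proof (rule Q.nondegenerate_form_represents)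
    show "x = 0" if "\<And>y. h x y = 0" for x
      using nondeg[of x] h that by (metis of_rat_0)
  qed (auto simp: Vector_Spaces.linear_iff Q.vector_space_axioms vs h k add scale of_rat_add of_rat_mult intro!: inj)
  then show ?thesis using h k by metis
qed

text \<open>Justifies the \<open>THE\<close> in \<open>line_bundle_quaternion\<close>: rationality
  of \<open>g\<close> and of the trace gives existence in the algebra, nondegeneracy of the trace
  form gives uniqueness.\<close>

lemma trace_form_represents:
  fixes g :: "'b \<Rightarrow> real"
  assumes "\<And>x. g x \<in> \<rat>" "\<And>x y. g (x + y) = g x + g y"
    "\<And>q x. g (\<iota> (of_rat q) * x) = of_rat q * g x"
  shows "\<exists>!\<mu>. \<forall>\<beta>. g \<beta> = quaternion_trace \<iota> (\<mu> * \<beta>)"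
proof -
  have comm: "x * (\<iota> a * y) = \<iota> a * (x * y)" for x y a
  proof -
    have "\<iota> a * x = x * \<iota> a" using quat unfolding quaternion_algebra_def by blast
    then show ?thesis by (simp flip: mult.assoc)
  qed
  have nondeg: "x = 0" if "\<And>y. quaternion_trace \<iota> (x * y) = 0" for x
  proof -
    obtain p :: 'n where True by blast
    have "r p x = 0"
      by (rule trace_form_nondegenerate[of "\<lambda>p. r p x"]) (use that in \<open>simp add: quaternion_trace_eq r_mult\<close>)
    then show ?thesis by simp
  qed
  have add: "quaternion_trace \<iota> (x + y) = quaternion_trace \<iota> x + quaternion_trace \<iota> y" for x y
    by (simp add: quaternion_trace_eq r_add trace_add sum.distrib)
  have scale: "quaternion_trace \<iota> (\<iota> (of_rat q) * x) = of_rat q * quaternion_trace \<iota> x" for q x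
    by (simp add: quaternion_trace_eq r_scale trace_scaleR sum_distrib_left)
  have "\<exists>\<mu>. \<forall>\<beta>. g \<beta> = quaternion_trace \<iota> (\<mu> * \<beta>)"
    by (rule rational_form_represents)
      (use assms nondeg in \<open>auto simp: quaternion_trace_rational distrib_left distrib_right add scale comm mult.assoc\<close>)
  moreover have "\<mu> = \<mu>'" if "\<forall>\<beta>. g \<beta> = quaternion_trace \<iota> (\<mu> * \<beta>)" "\<forall>\<beta>. g \<beta> = quaternion_trace \<iota> (\<mu>' * \<beta>)" for \<mu> \<mu>'
  proof -
    have "quaternion_trace \<iota> ((\<mu> - \<mu>') * y) = 0" for y
      using add[of "(\<mu> - \<mu>') * y" "\<mu>' * y"] that by (simp add: left_diff_distrib)
    then show ?thesis using nondeg[of "\<mu> - \<mu>'"] by simp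
  qed
  ultimately show ?thesis by blast
qed

text \<open>Cayley-Hamilton shows that \<mu> squares to minus the determinant in each block. That
  all these determinants come from one element of the field is the quadratic equation of \<mu> with
  vanishing linear term or, for central \<mu>, just the fact that its square is central.\<close>

lemma emb_quaternion_delta:
  assumes "\<And>p. trace (r p \<mu>) = 0"
  shows "emb p (quaternion_delta \<iota> \<mu>) = det (r p \<mu>)"
proof -
  have sq: "r q (\<mu> * \<mu>) = - (det (r q \<mu>) *\<^sub>R mat 1)" for q
    using cayley_hamilton_2x2[of "r q \<mu>"] assms[of q] by (simp add: r_mult)
  have "\<exists>d. \<mu> * \<mu> + \<iota> d = 0"
  proof (cases "\<mu> \<in> range \<iota>")
    case True
    then obtain a where "\<mu> = \<iota> a" by blast
    then have "\<mu> * \<mu> + \<iota> (- (a * a)) = 0" by (simp add: \<iota>_minus \<iota>_mult)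
    then show ?thesis by blast
  next
    case False
    obtain t m where tm: "\<mu> * \<mu> - \<iota> t * \<mu> + \<iota> m = 0" using quaternion_quadratic[OF False] by blast
    have "reduced_trace \<iota> \<mu> = t"
      unfolding reduced_trace_def using False tm quadratic_unique[OF False] by (auto intro!: the_equality)
    then have "t = 0" using emb_reduced_trace[of p \<mu>] assms[of p] by simp
    then show ?thesis using tm by auto
  qed
  then obtain d where d: "\<mu> * \<mu> + \<iota> d = 0" by blast
  then have "quaternion_delta \<iota> \<mu> = d"
    unfolding quaternion_delta_def by (auto intro!: the_equality) (metis \<iota>_eq_iff add_left_cancel)
  moreover have "r p (\<mu> * \<mu>) + mat (emb p d) = 0" using d by (metis r_0 r_add r_central)
  then have "emb p d *\<^sub>R mat 1 = det (r p \<mu>) *\<^sub>R (mat 1 :: real^2^2)"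
    by (simp add: sq mat_eq_scaleR[of "emb p d"])
  then have "emb p d = det (r p \<mu>)" by (simp add: vec_eq_iff mat_def forall_2)
  ultimately show ?thesis by simp
qed

end

section \<open>Endomorphisms and the polarization\<close>

text \<open>\<open>block_diag\<close> covers only blocks coming from the algebra. Arbitrary real
  blocks are needed for the hermitian matrices and for their eigenvectors.\<close>

definition block_matrix :: "('n::finite \<Rightarrow> real^2^2) \<Rightarrow> complex^('n \<times> 2)^('n \<times> 2)" where
  "block_matrix A = (\<chi> a b. if fst a = fst b then of_real (A (fst a) $ snd a $ snd b) else 0)"

lemma sum_prod_2: "(\<Sum>a\<in>UNIV. f a) = (\<Sum>p\<in>UNIV. f (p, 1) + f (p, 2))"
  for f :: "'n::finite \<times> 2 \<Rightarrow> 'c::comm_monoid_add"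
proof -
  have "(\<Sum>a\<in>UNIV. f a) = (\<Sum>p\<in>UNIV. \<Sum>i\<in>UNIV. f (p, i))"
    by (simp add: sum.cartesian_product flip: UNIV_Times_UNIV)
  then show ?thesis by (simp add: sum_2)
qed

lemma block_matrix_mult: "block_matrix A ** block_matrix B = block_matrix (\<lambda>p. A p ** B p)"
  by (simp add: vec_eq_iff matrix_matrix_mult_def block_matrix_def sum_prod_2 sum_2 sum.delta
      if_distrib[of "\<lambda>x. x * _"] if_distrib[of "\<lambda>x. _ * x"] if_distrib[of "\<lambda>x. x + _"] if_distrib[of "\<lambda>x. _ + x"] cong: if_cong)

lemma block_matrix_1: "block_matrix (\<lambda>_. mat 1) = mat 1"
  by (auto simp: vec_eq_iff block_matrix_def mat_def)

lemma block_matrix_add: "block_matrix (\<lambda>p. A p + B p) = block_matrix A + block_matrix B"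
  by (simp add: vec_eq_iff block_matrix_def)

lemma invertible_block_matrix:
  assumes "\<And>p. invertible (A p)"
  shows "invertible (block_matrix A)"
proof -
  have "\<forall>p. \<exists>B. A p ** B = mat 1 \<and> B ** A p = mat 1" using assms by (auto simp: invertible_def)
  then obtain B where "\<And>p. A p ** B p = mat 1" "\<And>p. B p ** A p = mat 1" by metis
  then have "block_matrix A ** block_matrix B = mat 1" "block_matrix B ** block_matrix A = mat 1"
    by (simp_all add: block_matrix_mult block_matrix_1)
  then show ?thesis by (auto simp: invertible_def)
qed

lemma matrix_vector_mult_imp_eq: "(\<And>x. A *v x = B *v x) \<Longrightarrow> A = B"
  for A B :: "'a::{comm_semiring_1}^'n^'m"
  by (simp add: matrix_eq)

section \<open>Riemann forms compatible with the complex structure\<close>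

lemma neron_severiD:
  assumes "E \<in> neron_severi \<Lambda>"
  shows "bilinear E" "E x x = 0" "E (\<i> *s x) (\<i> *s y) = E x y"
    "x \<in> \<Lambda> \<Longrightarrow> y \<in> \<Lambda> \<Longrightarrow> E x y \<in> \<int>"
  using assms by (auto simp: neron_severi_def)

lemma vec_complex_smult_simps [simp]:
  "\<i> *s (\<i> *s x) = - x" "\<i> *s (c *\<^sub>R x) = c *\<^sub>R (\<i> *s x)" for x :: "complex^'n"
  by (simp_all add: vec_eq_iff scaleR_conv_of_real)

lemma neron_severi_swap:
  assumes "E \<in> neron_severi \<Lambda>"
  shows "E y x = - E x y"
proof -
  note E = neron_severiD[OF assms]
  have "E (x + y) (x + y) = E x x + E y x + (E x y + E y y)"
    using E(1) by (simp add: bilinear_ladd bilinear_radd)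
  then show ?thesis by (simp add: E(2))
qed

lemma i_compatible_swap:
  fixes G :: "complex^'d::finite \<Rightarrow> complex^'d \<Rightarrow> real"
  assumes "bilinear G" "\<And>x y. G (\<i> *s x) (\<i> *s y) = G x y"
  shows "G (\<i> *s x) y = - G x (\<i> *s y)"
proof -
  have "G (\<i> *s x) y = G (\<i> *s (\<i> *s x)) (\<i> *s y)" by (simp only: assms(2))
  then show ?thesis using assms(1) by (simp add: bilinear_lneg)
qed

lemma polarization_nondegenerate:
  assumes "polarization \<Lambda> E" "\<And>y. E x y = 0"
  shows "x = 0"
proof (rule ccontr)
  assume "x \<noteq> 0"
  have E: "E \<in> neron_severi \<Lambda>" using assms(1) by (simp add: polarization_def)
  have "E (\<i> *s x) x = 0"
    using i_compatible_swap[OF neron_severiD(1,3)[OF E], of x x] assms(2) by simp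
  moreover have "Re (hermitian_form E x x) > 0" using assms(1) \<open>x \<noteq> 0\<close> by (simp add: polarization_def)
  ultimately show False by (simp add: hermitian_form_def)
qed

section \<open>The torus, the orbit of its base vector, and denominators\<close>

locale quaternionic_torus = split_quaternion_algebra emb \<iota> \<rho>
  for emb :: "'n::finite \<Rightarrow> 'f::field_char_0 \<Rightarrow> real" and \<iota> :: "'f \<Rightarrow> 'b::division_ring"
    and \<rho> :: "('f \<Rightarrow> real) \<Rightarrow> 'b \<Rightarrow> real^2^2" +
  fixes R I :: "'b set" and \<tau> :: "('f \<Rightarrow> real) \<Rightarrow> complex"
  assumes order: "quaternion_order \<iota> R"
    and ideal: "left_order_ideal \<iota> R I"
    and abelian: "abelian_variety (qm_lattice emb \<rho> \<tau> I)"
    and qm: "quaternionic_multiplication emb \<rho> R (qm_lattice emb \<rho> \<tau> I)"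
begin

abbreviation "bd \<equiv> block_diag emb \<rho>"
abbreviation "v0 \<equiv> base_vector emb \<tau>"
text \<open>The orbit map of \<open>v0\<close> sends \<open>I\<close> onto the lattice and so
  identifies the algebra with the rational span of the lattice; a form rational on the lattice
  becomes a rational form on the algebra.\<close>

abbreviation "e \<beta> \<equiv> bd \<beta> *v v0"
abbreviation "\<Lambda> \<equiv> qm_lattice emb \<rho> \<tau> I"

lemma bd_eq: "bd \<beta> = block_matrix (\<lambda>p. r p \<beta>)"
  by (simp add: block_diag_def block_matrix_def)

lemma bd_mult: "bd (x * y) = bd x ** bd y"
  by (simp add: bd_eq r_mult block_matrix_mult)

lemma bd_add: "bd (x + y) = bd x + bd y"
  by (simp add: bd_eq r_add block_matrix_add)

lemma bd_scale: "bd (\<iota> (of_rat q) * x) *v y = of_rat q *\<^sub>R (bd x *v y)"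
  by (simp add: bd_eq r_scale block_matrix_def vec_eq_iff matrix_vector_mult_def scaleR_conv_of_real[where 'a=complex]
      if_distrib[of "\<lambda>x. x * _"] if_distrib[of "\<lambda>x. _ * x"] sum_distrib_left mult.assoc cong: if_cong)

lemma bd_inj: "bd x = bd y \<Longrightarrow> x = y"
proof -
  assume eq: "bd x = bd y"
  obtain p :: 'n where True by blast
  have "bd x $ (p, i) $ (p, j) = bd y $ (p, i) $ (p, j)" for i j by (simp add: eq)
  then have "r p x = r p y" by (simp add: bd_eq block_matrix_def vec_eq_iff)
  then show "x = y" by simp
qed

lemma e_mult: "e (x * y) = bd x *v e y"
  by (simp add: bd_mult matrix_vector_mul_assoc)

lemma e_add: "e (x + y) = e x + e y"
  by (simp add: bd_add matrix_vector_mult_add_rdistrib)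

lemma e_1: "e 1 = v0"
  by (simp add: bd_eq block_matrix_1)

lemma e_diff: "e (x - y) = e x - e y"
  using e_add[of "x - y" y] by simp

text \<open>For nonzero \<open>x\<close>, the vector \<open>v0\<close> is the image of
  \<open>e x\<close> under \<open>inverse x\<close>; but \<open>v0\<close> has coordinate 1 at every
  second position and is not zero.\<close>

lemma e_eq_0: "e x = 0 \<Longrightarrow> x = 0"
proof (rule ccontr)
  assume "e x = 0" "x \<noteq> 0"
  then have "v0 = e (inverse x * x)" using e_1 by simp
  also have "\<dots> = 0" by (simp only: e_mult \<open>e x = 0\<close> matrix_vector_mult_0_right)
  finally have "v0 $ (undefined, 2) = 0" by simp
  then show False by (simp add: base_vector_def)
qed

lemma e_inj: "e x = e y \<Longrightarrow> x = y"
  using e_eq_0[of "x - y"] by (simp add: e_diff)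

lemma lattice_basis:
  obtains S where "finite S" "S \<subseteq> \<Lambda>" "span S = UNIV"
    "\<And>x. x \<in> \<Lambda> \<longleftrightarrow> (\<exists>c :: _ \<Rightarrow> int. x = (\<Sum>b\<in>S. of_int (c b) *\<^sub>R b))"
proof -
  obtain S where S: "independent S" "span S = UNIV"
    "\<Lambda> = {\<Sum>b\<in>S. of_int (c b) *\<^sub>R b | c :: _ \<Rightarrow> int. True}"
    using abelian by (auto simp: abelian_variety_def full_lattice_def)
  then have mem: "x \<in> \<Lambda> \<longleftrightarrow> (\<exists>c :: _ \<Rightarrow> int. x = (\<Sum>b\<in>S. of_int (c b) *\<^sub>R b))" for x by simp
  have fS: "finite S" using S(1) by (rule independent_imp_finite)
  have "S \<subseteq> \<Lambda>"
  proof
    fix s assume s: "s \<in> S"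
    have "(\<Sum>b\<in>S. of_int (if b = s then 1 else 0) *\<^sub>R b) = s"
      using fS s by (simp add: if_distrib[of of_int] if_distrib[of "\<lambda>c. c *\<^sub>R _"] cong: if_cong)
    then show "s \<in> \<Lambda>" unfolding mem by (intro exI[of _ "\<lambda>b. if b = s then 1 else 0"]) (rule sym)
  qed
  with S fS mem that show ?thesis by blast
qed

lemma lattice_add: "x \<in> \<Lambda> \<Longrightarrow> y \<in> \<Lambda> \<Longrightarrow> x + y \<in> \<Lambda>"
proof -
  obtain S where "finite S" "S \<subseteq> \<Lambda>" "span S = UNIV"
    and S: "\<And>x. x \<in> \<Lambda> \<longleftrightarrow> (\<exists>c :: _ \<Rightarrow> int. x = (\<Sum>b\<in>S. of_int (c b) *\<^sub>R b))"
    by (rule lattice_basis) blast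
  assume "x \<in> \<Lambda>" "y \<in> \<Lambda>"
  then obtain c c' :: "_ \<Rightarrow> int" where "x = (\<Sum>b\<in>S. of_int (c b) *\<^sub>R b)" "y = (\<Sum>b\<in>S. of_int (c' b) *\<^sub>R b)"
    using S by meson
  then have "x + y = (\<Sum>b\<in>S. of_int ((\<lambda>b. c b + c' b) b) *\<^sub>R b)"
    by (simp add: scaleR_left_distrib sum.distrib)
  then show ?thesis unfolding S by (rule exI[of _ "\<lambda>b. c b + c' b"])
qed

lemma lattice_scale: "x \<in> \<Lambda> \<Longrightarrow> of_int k *\<^sub>R x \<in> \<Lambda>"
proof -
  obtain S where "finite S" "S \<subseteq> \<Lambda>" "span S = UNIV"
    and S: "\<And>x. x \<in> \<Lambda> \<longleftrightarrow> (\<exists>c :: _ \<Rightarrow> int. x = (\<Sum>b\<in>S. of_int (c b) *\<^sub>R b))"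
    by (rule lattice_basis) blast
  assume "x \<in> \<Lambda>"
  then obtain c :: "_ \<Rightarrow> int" where "x = (\<Sum>b\<in>S. of_int (c b) *\<^sub>R b)" using S by meson
  then have "of_int k *\<^sub>R x = (\<Sum>b\<in>S. of_int ((\<lambda>b. k * c b) b) *\<^sub>R b)" by (simp add: scaleR_sum_right)
  then show ?thesis unfolding S by (rule exI[of _ "\<lambda>b. k * c b"])
qed

text \<open>Additivity is transported from the lattice, a group by its integral basis, through the
  injective \<open>e\<close>. From the presentation of \<open>I\<close> it would require that sums
  of algebraic integers are integral.\<close>

lemma ideal_add: "x \<in> I \<Longrightarrow> y \<in> I \<Longrightarrow> x + y \<in> I"
proof -
  assume "x \<in> I" "y \<in> I"
  then have "e x + e y \<in> \<Lambda>" by (intro lattice_add) (auto simp: qm_lattice_def)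
  then obtain z where "z \<in> I" "e (x + y) = e z" by (auto simp: qm_lattice_def e_add)
  then show ?thesis using e_inj by blast
qed

lemma order_endomorphism: "x \<in> R \<Longrightarrow> (*v) (bd x) \<in> torus_endomorphisms \<Lambda>"
  and endomorphism_order: "f \<in> torus_endomorphisms \<Lambda> \<Longrightarrow> \<exists>x\<in>R. f = (*v) (bd x)"
  using qm by (auto simp: quaternionic_multiplication_def bij_betw_def)

text \<open>As for the ideal, but through the endomorphism ring: a sum of two endomorphisms of the
  torus is again one, hence the action of an element of \<open>R\<close>.\<close>

lemma order_add: "x \<in> R \<Longrightarrow> y \<in> R \<Longrightarrow> x + y \<in> R"
proof -
  assume "x \<in> R" "y \<in> R"
  then have "(\<lambda>v. bd x *v v + bd y *v v) \<in> torus_endomorphisms \<Lambda>"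
    using order_endomorphism[of x] order_endomorphism[of y]
    by (auto simp: torus_endomorphisms_def vec.linear_compose_add image_subset_iff lattice_add)
  then obtain z where z: "z \<in> R" "(\<lambda>v. bd x *v v + bd y *v v) = (*v) (bd z)"
    using endomorphism_order by blast
  then have "bd z = bd (x + y)"
    by (intro matrix_vector_mult_imp_eq) (simp add: bd_add matrix_vector_mult_add_rdistrib fun_eq_iff)
  then show ?thesis using bd_inj z by blast
qed

text \<open>Each coefficient in the field has a nonzero integer multiple that is an algebraic
  integer, and the induction over a linear combination multiplies these denominators. Additivity of
  \<open>L\<close> is an assumption because \<open>I\<close> and \<open>R\<close> obtain it from the
  torus.\<close>

lemma quaternion_lattice_multiple:
  assumes L: "quaternion_lattice \<iota> L" and add: "\<And>x y. x \<in> L \<Longrightarrow> y \<in> L \<Longrightarrow> x + y \<in> L"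
  shows "\<exists>m::nat. m > 0 \<and> of_nat m * \<beta> \<in> L"
proof -
  obtain S where S: "finite S" "L = {\<Sum>s\<in>S. \<iota> (c s) * s | c. \<forall>s\<in>S. algebraic_int (c s)}"
    using L by (auto simp: quaternion_lattice_def)
  have zero: "0 \<in> L" unfolding S(2) by (intro CollectI exI[of _ "\<lambda>_. 0"]) simp
  have mult: "of_nat m * x \<in> L" if "x \<in> L" for x and m :: nat
  proof (induction m)
    case 0
    show ?case using zero by simp
  qed (use that add in \<open>simp add: distrib_right\<close>)
  have "L \<subseteq> F.span S" unfolding S(2) by clarify (rule F.span_sum, rule F.span_scale, rule F.span_base)
  then have "F.span S = UNIV"
    using L F.span_minimal[of L "F.span S"] by (auto simp: quaternion_lattice_def)
  then have "\<beta> \<in> F.span S" by simp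
  then show ?thesis
  proof (induction rule: F.span_induct_alt)
    case base
    show ?case using zero by (intro exI[of _ 1]) simp
  next
    case (step c s y)
    then obtain m where m: "m > 0" "of_nat m * y \<in> L" by blast
    obtain k :: int where k: "k \<noteq> 0" "algebraic_int (of_int k * c)" using algebraic_int_multiple by blast
    then have k': "algebraic_int (of_nat (nat \<bar>k\<bar>) * c)"
      by (cases "k > 0") (auto simp: abs_if)
    let ?k = "nat \<bar>k\<bar>"
    have "of_nat ?k * (\<iota> c * s) \<in> L"
      unfolding S(2)
    proof (intro CollectI exI[of _ "\<lambda>t. if t = s then of_nat ?k * c else 0"] conjI)
      have "(\<Sum>t\<in>S. \<iota> (if t = s then of_nat ?k * c else 0) * t) = (\<Sum>t\<in>S. if t = s then \<iota> (of_nat ?k * c) * t else 0)"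
        by (rule sum.cong) auto
      also have "\<dots> = \<iota> (of_nat ?k * c) * s" using S(1) step by simp
      finally show "of_nat ?k * (\<iota> c * s) = (\<Sum>t\<in>S. \<iota> (if t = s then of_nat ?k * c else 0) * t)"
        by (simp only: \<iota>_mult \<iota>_of_nat mult.assoc)
    qed (use k' in simp)
    from add[OF mult[OF this] mult[OF m(2)]] have "of_nat m * (of_nat ?k * (\<iota> c * s)) + of_nat ?k * (of_nat m * y) \<in> L"
      .
    also have "of_nat m * (of_nat ?k * (\<iota> c * s)) + of_nat ?k * (of_nat m * y) = of_nat (m * ?k) * (\<iota> c * s + y)"
    proof -
      have "of_nat a * (of_nat b * z) = of_nat (a * b) * z" for a b and z :: 'b
        by (simp add: mult.assoc)
      then show ?thesis by (simp only: mult.commute[of ?k m] distrib_left)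
    qed
    finally show ?case using m k by (intro exI[of _ "m * ?k"]) simp
  qed
qed

lemma ideal_multiple: "\<exists>m::nat. m > 0 \<and> of_nat m * \<beta> \<in> I"
  using ideal ideal_add by (intro quaternion_lattice_multiple) (auto simp: left_order_ideal_def)

lemma order_multiple: "\<exists>m::nat. m > 0 \<and> of_nat m * \<beta> \<in> R"
  using order order_add by (intro quaternion_lattice_multiple) (auto simp: quaternion_order_def)

lemma e_scale: "e (\<iota> (of_rat q) * x) = of_rat q *\<^sub>R e x"
  by (rule bd_scale)

lemma bd_of_nat: "bd (of_nat m * x) *v y = of_nat m *\<^sub>R (bd x *v y)"
  using bd_scale[of "of_nat m" x y] by (simp add: \<iota>_of_nat)

lemma neron_severi_rational:
  assumes G: "G \<in> neron_severi \<Lambda>"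
  shows "G (e x) (e y) \<in> \<rat>"
proof -
  obtain m where m: "m > 0" "of_nat m * x \<in> I" using ideal_multiple by blast
  obtain k where k: "k > 0" "of_nat k * y \<in> I" using ideal_multiple by blast
  have "G (e (of_nat m * x)) (e (of_nat k * y)) \<in> \<int>"
    using m k by (intro neron_severiD(4)[OF G]) (auto simp: qm_lattice_def)
  also have "G (e (of_nat m * x)) (e (of_nat k * y)) = of_nat (m * k) * G (e x) (e y)"
    using neron_severiD(1)[OF G] by (simp add: bd_of_nat bilinear_lmul bilinear_rmul)
  finally have "of_nat (m * k) * G (e x) (e y) / of_nat (m * k) \<in> \<rat>"
    by (intro Rats_divide) (use Ints_subset_Rats in auto)
  then show ?thesis using m k by simp
qed

lemma zero_on_e_imp_zero:
  assumes G: "linear g" and "\<And>x. g (e x) = 0"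
  shows "g y = (0 :: real)"
proof -
  obtain S where S: "S \<subseteq> \<Lambda>" "span S = UNIV" by (rule lattice_basis) blast
  have "y \<in> span S" using S by simp
  then show ?thesis
  proof (induction rule: span_induct_alt)
    case base show ?case using G by (rule linear_0)
  next
    case (step c x y)
    then have "x \<in> range e" using S by (auto simp: qm_lattice_def)
    then have "g x = 0" using assms(2) by auto
    with step show ?case using G by (simp add: linear_add linear_scale)
  qed
qed

text \<open>
  The polarization identifies rational forms compatible with the complex structure with
  endomorphisms up to isogeny; as these all come from the order, so does the form.
\<close>

lemma form_from_polarization:
  assumes E0: "polarization \<Lambda> E0"
    and G: "bilinear G" "\<And>x y. G (\<i> *s x) (\<i> *s y) = G x y" "\<And>x y. G (e x) (e y) \<in> \<rat>"
  shows "\<exists>\<beta>\<in>R. \<exists>N::nat. N > 0 \<and> (\<forall>x y. E0 (bd \<beta> *v x) y = of_nat N * G x y)"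
proof -
  have E0n: "E0 \<in> neron_severi \<Lambda>" using E0 by (simp add: polarization_def)
  note E0b = neron_severiD(1)[OF E0n]
  note E0i = neron_severiD(3)[OF E0n]
  have lin: "linear (B x)" "linear (\<lambda>x. B x y)" if "bilinear B" for B :: "complex^('n \<times> 2) \<Rightarrow> complex^('n \<times> 2) \<Rightarrow> real" and x y
    using that by (auto simp: bilinear_def)
  \<comment> \<open>Over the reals, \<open>G x\<close> is represented by a unique vector
    \<open>T x\<close>. Uniqueness makes \<open>T\<close> real linear, and compatibility of both
    forms with \<open>\<i>\<close> makes it complex linear.\<close>
  have "\<exists>z. \<forall>y. G x y = E0 z y" for x
  proof -
    obtain S :: "(complex^('n \<times> 2)) set" where "finite S" "span S = UNIV" by (rule lattice_basis) blast
    moreover have lin_eq: "Vector_Spaces.linear (*\<^sub>R) (*) g" if "linear g" for g :: "complex^('n \<times> 2) \<Rightarrow> real"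
      using that unfolding linear_def real_scaleR_def[abs_def] .
    ultimately show ?thesis
      using real_vector.nondegenerate_form_represents[of S E0 "G x"]
        lin_eq[OF lin(1)[OF E0b]] lin_eq[OF lin(2)[OF E0b]] lin_eq[OF lin(1)[OF G(1)]]
        polarization_nondegenerate[OF E0] unfolding span_raw_def by meson
  qed
  then obtain T where T: "\<And>x y. G x y = E0 (T x) y" by metis
  have uniq: "z = w" if "\<And>y. E0 z y = E0 w y" for z w
    using polarization_nondegenerate[OF E0, of "z - w"] that by (simp add: bilinear_lsub[OF E0b])
  have T_add: "T (x + y) = T x + T y" for x y
    by (rule uniq) (simp add: bilinear_ladd[OF E0b] bilinear_ladd[OF G(1)] flip: T)
  have T_scale: "T (c *\<^sub>R x) = c *\<^sub>R T x" for c x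
    by (rule uniq) (simp add: bilinear_lmul[OF E0b] bilinear_lmul[OF G(1)] flip: T)
  have T_i: "T (\<i> *s x) = \<i> *s T x" for x
    by (rule uniq) (simp add: i_compatible_swap[OF E0b E0i] i_compatible_swap[OF G(1,2)] flip: T)
  \<comment> \<open>The same equation solved over the rationals has its solution in the orbit
    \<open>e\<close>. Both solutions agree against the orbit, which spans over the reals, so they
    coincide.\<close>
  have T_e: "\<exists>b. T (e x) = e b" for x
  proof -
    have "\<exists>b. \<forall>y. G (e x) (e y) = E0 (e b) (e y)"
    proof (rule rational_form_represents)
      show "E0 (e x) (e y) \<in> \<rat>" for x y by (rule neron_severi_rational[OF E0n])
      show "x = 0" if "\<And>y. E0 (e x) (e y) = 0" for x
        using zero_on_e_imp_zero[OF lin(1)[OF E0b]] that polarization_nondegenerate[OF E0] e_eq_0 by blast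
    qed (simp_all add: G e_add e_scale bilinear_ladd[OF E0b] bilinear_radd[OF E0b] bilinear_radd[OF G(1)]
        bilinear_lmul[OF E0b] bilinear_rmul[OF E0b] bilinear_rmul[OF G(1)])
    then obtain b where b: "\<And>y. G (e x) (e y) = E0 (e b) (e y)" by blast
    have "E0 (T (e x) - e b) y = 0" for y
      by (rule zero_on_e_imp_zero[OF lin(1)[OF E0b]]) (simp add: bilinear_lsub[OF E0b] b flip: T)
    then have "T (e x) - e b = 0" by (rule polarization_nondegenerate[OF E0])
    then show ?thesis by auto
  qed
  obtain S where S: "finite S" "S \<subseteq> \<Lambda>"
    "\<And>x. x \<in> \<Lambda> \<longleftrightarrow> (\<exists>c :: _ \<Rightarrow> int. x = (\<Sum>b\<in>S. of_int (c b) *\<^sub>R b))" by (rule lattice_basis) blast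
  have "\<exists>m::nat. m > 0 \<and> of_nat m *\<^sub>R T s \<in> \<Lambda>" if "s \<in> S" for s
  proof -
    have "s \<in> \<Lambda>" using that S(2) by blast
    then obtain x where "s = e x" by (auto simp: qm_lattice_def)
    then obtain b where b: "T s = e b" using T_e by blast
    obtain m :: nat where "m > 0" "of_nat m * b \<in> I" using ideal_multiple by blast
    then show ?thesis by (intro exI[of _ m]) (auto simp: b qm_lattice_def simp flip: bd_of_nat)
  qed
  then obtain m :: "_ \<Rightarrow> nat" where m: "\<And>s. s \<in> S \<Longrightarrow> m s > 0 \<and> of_nat (m s) *\<^sub>R T s \<in> \<Lambda>" by metis
  \<comment> \<open>A common denominator of \<open>T\<close> on a finite generating set of the
    lattice turns \<open>T\<close> into an endomorphism of the torus, which \<open>qm\<close> places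
    in \<open>R\<close>.\<close>
  define N where "N = (\<Prod>s\<in>S. m s)"
  have "N > 0" using m by (simp add: N_def prod_pos)
  have NT: "of_nat N *\<^sub>R T s \<in> \<Lambda>" if "s \<in> S" for s
  proof -
    have "N = (\<Prod>s\<in>S - {s}. m s) * m s" using that S(1) by (simp add: N_def prod.remove mult.commute)
    then have "of_nat N *\<^sub>R T s = of_int (int (\<Prod>s\<in>S - {s}. m s)) *\<^sub>R (of_nat (m s) *\<^sub>R T s)"
      by (simp only: of_nat_mult scaleR_scaleR of_int_of_nat_eq)
    then show ?thesis using m[OF that] lattice_scale by metis
  qed
  have Tlin: "linear T" using T_add T_scale by (intro linearI)
  let ?f = "\<lambda>x. of_nat N *\<^sub>R T x"
  have "?f ` \<Lambda> \<subseteq> \<Lambda>"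
  proof
    fix y assume "y \<in> ?f ` \<Lambda>"
    then obtain x where "x \<in> \<Lambda>" "y = ?f x" by blast
    moreover from this S(3) obtain c :: "_ \<Rightarrow> int" where "x = (\<Sum>b\<in>S. of_int (c b) *\<^sub>R b)" by meson
    ultimately have y: "y = ?f (\<Sum>b\<in>S. of_int (c b) *\<^sub>R b)" by simp
    have y': "y = (\<Sum>b\<in>S. of_int (c b) *\<^sub>R ?f b)"
      unfolding y linear_sum[OF Tlin] by (simp add: T_scale scaleR_sum_right mult.commute)
    have zero: "0 \<in> \<Lambda>" unfolding S(3) by (rule exI[of _ "\<lambda>_. 0"]) simp
    have "finite A \<Longrightarrow> A \<subseteq> S \<Longrightarrow> (\<Sum>b\<in>A. of_int (c b) *\<^sub>R ?f b) \<in> \<Lambda>" for A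
    proof (induction rule: finite_induct)
      case (insert a A)
      then have "of_int (c a) *\<^sub>R ?f a \<in> \<Lambda>" using NT lattice_scale by blast
      with insert show ?case by (simp add: lattice_add)
    qed (simp add: zero)
    then show "y \<in> \<Lambda>" unfolding y' using S(1) by blast
  qed
  moreover have "Vector_Spaces.linear (*s) (*s) ?f"
  proof -
    have "T (c *s x) = c *s T x" for c x
    proof -
      have split: "c *s z = Re c *\<^sub>R z + Im c *\<^sub>R (\<i> *s z)" for z :: "complex^('n \<times> 2)"
        by (simp add: vec_eq_iff complex_eq_iff)
      show ?thesis unfolding split[of x] split[of "T x"] by (simp add: T_add T_scale T_i)
    qed
    then show ?thesis
      by (auto simp: Vector_Spaces.linear_iff vec.vector_space_axioms T_add scaleR_right_distrib vec_eq_iff)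
  qed
  ultimately obtain \<beta> where \<beta>: "\<beta> \<in> R" "?f = (*v) (bd \<beta>)"
    using endomorphism_order[of ?f] by (auto simp: torus_endomorphisms_def)
  have "E0 (bd \<beta> *v x) y = of_nat N * G x y" for x y
    using fun_cong[OF \<beta>(2), of x] by (simp add: T bilinear_lmul[OF E0b] flip: \<beta>(2))
  with \<open>N > 0\<close> \<beta>(1) show ?thesis by blast
qed

end

section \<open>The block structure of the hermitian matrix\<close>

lemma hermitian_form_add:
  assumes "bilinear E"
  shows "hermitian_form E (x + x') y = hermitian_form E x y + hermitian_form E x' y"
  using assms by (simp add: hermitian_form_def vector_add_ldistrib bilinear_ladd algebra_simps)

lemma hermitian_form_scale:
  assumes E: "bilinear E"
  shows "hermitian_form E (c *s x) y = c * hermitian_form E x y"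
proof -
  have split: "c *s x = Re c *\<^sub>R x + Im c *\<^sub>R (\<i> *s x)"
    by (simp add: vec_eq_iff complex_eq_iff)
  have real: "hermitian_form E (k *\<^sub>R x) y = of_real k * hermitian_form E x y" for k x
    using E by (simp add: hermitian_form_def bilinear_lmul algebra_simps)
  have i: "hermitian_form E (\<i> *s x) y = \<i> * hermitian_form E x y"
    using E by (simp add: hermitian_form_def bilinear_lneg algebra_simps)
  show ?thesis
    unfolding split hermitian_form_add[OF E] real i by (simp add: complex_eq_iff)
qed

lemma hermitian_form_cnj:
  assumes "E \<in> neron_severi \<Lambda>"
  shows "hermitian_form E y x = cnj (hermitian_form E x y)"
proof -
  note E = neron_severiD[OF assms]
  have "E (\<i> *s y) x = E (\<i> *s x) y"
    using i_compatible_swap[OF E(1,3), of y x] neron_severi_swap[OF assms, of "\<i> *s x" y] by simp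
  then show ?thesis using neron_severi_swap[OF assms, of y x] by (simp add: hermitian_form_def)
qed

lemma hermitian_form_expand:
  assumes "bilinear E"
  shows "hermitian_form E x y = (\<Sum>b\<in>UNIV. x $ b * hermitian_form E (axis b 1) y)"
proof -
  have 0: "hermitian_form E 0 y = 0"
    using hermitian_form_scale[OF assms, of 0 0 y] by simp
  have sum: "hermitian_form E (sum f A) y = (\<Sum>a\<in>A. hermitian_form E (f a) y)" for f and A :: "'b set"
    by (induction A rule: infinite_finite_induct) (simp_all add: 0 hermitian_form_add[OF assms])
  have "hermitian_form E x y = hermitian_form E (\<Sum>b\<in>UNIV. x $ b *s axis b 1) y"
    by (simp only: basis_expansion)
  then show ?thesis by (simp only: sum hermitian_form_scale[OF assms])
qed

lemma hermitian_form_matrix: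
  assumes "E \<in> neron_severi \<Lambda>"
  shows "hermitian_form E x y = (\<Sum>a\<in>UNIV. cnj (y $ a) * (hermitian_matrix E *v x) $ a)"
proof -
  note E = neron_severiD(1)[OF assms]
  have "hermitian_form E (axis b 1) y = (\<Sum>a\<in>UNIV. cnj (y $ a) * hermitian_matrix E $ a $ b)" for b
  proof -
    have "hermitian_form E (axis b 1) y = cnj (\<Sum>a\<in>UNIV. y $ a * hermitian_form E (axis a 1) (axis b 1))"
      unfolding hermitian_form_cnj[OF assms, of "axis b 1" y] hermitian_form_expand[OF E, of y] ..
    also have "\<dots> = (\<Sum>a\<in>UNIV. cnj (y $ a) * cnj (hermitian_form E (axis a 1) (axis b 1)))" by simp
    also have "\<dots> = (\<Sum>a\<in>UNIV. cnj (y $ a) * hermitian_matrix E $ a $ b)"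
      by (simp only: hermitian_matrix_def vec_lambda_beta flip: hermitian_form_cnj[OF assms])
    finally show ?thesis .
  qed
  then have "hermitian_form E x y = (\<Sum>b\<in>UNIV. x $ b * (\<Sum>a\<in>UNIV. cnj (y $ a) * hermitian_matrix E $ a $ b))"
    by (simp only: hermitian_form_expand[OF E, of x y])
  also have "\<dots> = (\<Sum>b\<in>UNIV. \<Sum>a\<in>UNIV. cnj (y $ a) * (hermitian_matrix E $ a $ b * x $ b))"
    unfolding sum_distrib_left by (intro sum.cong refl) (simp add: mult.commute mult.left_commute)
  also have "\<dots> = (\<Sum>a\<in>UNIV. \<Sum>b\<in>UNIV. cnj (y $ a) * (hermitian_matrix E $ a $ b * x $ b))"
    by (rule sum.swap)
  finally show ?thesis by (simp add: matrix_vector_mult_def sum_distrib_left)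
qed

lemma hermitian_matrix_cnj:
  assumes "E \<in> neron_severi \<Lambda>"
  shows "hermitian_matrix E $ a $ b = cnj (hermitian_matrix E $ b $ a)"
  unfolding hermitian_matrix_def vec_lambda_beta by (rule hermitian_form_cnj[OF assms])

text \<open>The matrix version of the adjunction, with the conjugate transpose of \<open>B\<close>
  on the right. Two forms and two matrices are allowed so that it serves both for adjoints, where
  \<open>E\<close> is \<open>E0\<close>, and for comparing \<open>E\<close> with \<open>E0\<close>,
  where \<open>B\<close> is the identity.\<close>

lemma hermitian_matrix_adjoint:
  assumes E0: "E0 \<in> neron_severi \<Lambda>" and E: "E \<in> neron_severi \<Lambda>"
    and eq: "\<And>x y. E0 (A *v x) y = c * E x (B *v y)"
  shows "(\<Sum>d\<in>UNIV. hermitian_matrix E0 $ a $ d * A $ d $ b)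
       = of_real c * (\<Sum>d\<in>UNIV. cnj (B $ d $ a) * hermitian_matrix E $ d $ b)"
proof -
  have axis: "(M *v axis b 1) $ d = M $ d $ b" for M :: "complex^'a^'a" and d b
    by (simp add: matrix_vector_mult_def axis_def if_distrib[of "\<lambda>x. _ * x"] cong: if_cong)
  have "hermitian_form E0 (A *v axis b 1) (axis a 1) = of_real c * hermitian_form E (axis b 1) (B *v axis a 1)"
    by (simp add: hermitian_form_def eq algebra_simps flip: vector_scalar_commute)
  also have "hermitian_form E (axis b 1) (B *v axis a 1) = (\<Sum>d\<in>UNIV. cnj (B $ d $ a) * hermitian_matrix E $ d $ b)"
    by (simp add: hermitian_form_matrix[OF E] axis)
  also have "hermitian_form E0 (A *v axis b 1) (axis a 1) = (\<Sum>d\<in>UNIV. hermitian_matrix E0 $ a $ d * A $ d $ b)"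
    by (subst hermitian_form_expand[OF neron_severiD(1)[OF E0]])
      (simp add: axis hermitian_matrix_def mult.commute)
  finally show ?thesis .
qed

lemma sum_block_matrix:
  "(\<Sum>d\<in>UNIV. f d * block_matrix A $ d $ (q, k)) = (\<Sum>j\<in>UNIV. f (q, j) * of_real (A q $ j $ k))"
proof -
  have "(\<Sum>d\<in>UNIV. f d * block_matrix A $ d $ (q, k))
      = (\<Sum>p\<in>UNIV. if p = q then \<Sum>j\<in>UNIV. f (q, j) * of_real (A q $ j $ k) else 0)"
    unfolding sum_prod_2 by (rule sum.cong) (simp_all add: block_matrix_def sum_2)
  then show ?thesis by simp
qed

lemma matrix_vector_mult_scaleR: "A *v (c *\<^sub>R x) = c *\<^sub>R (A *v x)" for A :: "complex^'n^'m"
  by (simp add: vec_eq_iff matrix_vector_mult_def scaleR_sum_right)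

section \<open>Blocks of the polarization and of the line bundle\<close>

context quaternionic_torus
begin

text \<open>The form \<open>E0 x (bd \<beta> *v y)\<close> is compatible with \<open>\<i>\<close>
  because matrices act complex linearly, and rational because
  \<open>bd \<beta> *v e y = e (\<beta> * y)\<close>. As the blocks are real, the conjugate
  transpose in the adjunction is a plain transpose, and the relation splits into one for each pair
  of embeddings.\<close>

lemma adjoint_matrix:
  assumes E0: "polarization \<Lambda> E0" and \<beta>: "\<beta> \<in> R"
  defines "S \<equiv> hermitian_matrix E0"
  shows "\<exists>\<beta>'. \<exists>N::nat. N > 0 \<and> (\<forall>p q i k.
    (\<Sum>j\<in>UNIV. S $ (p, i) $ (q, j) * of_real (r q \<beta>' $ j $ k))
      = of_nat N * (\<Sum>j\<in>UNIV. of_real (r p \<beta> $ j $ i) * S $ (p, j) $ (q, k)))"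
proof -
  have E0n: "E0 \<in> neron_severi \<Lambda>" using E0 by (simp add: polarization_def)
  note E0b = neron_severiD(1)[OF E0n]
  let ?G = "\<lambda>x y. E0 x (bd \<beta> *v y)"
  have "bilinear ?G"
    unfolding bilinear_def
    by (auto intro!: linearI simp: matrix_vector_right_distrib matrix_vector_mult_scaleR
        bilinear_ladd[OF E0b] bilinear_radd[OF E0b] bilinear_lmul[OF E0b] bilinear_rmul[OF E0b])
  moreover have "?G (\<i> *s x) (\<i> *s y) = ?G x y" for x y
    by (simp add: neron_severiD(3)[OF E0n] vector_scalar_commute)
  moreover have "?G (e x) (e y) \<in> \<rat>" for x y
    using neron_severi_rational[OF E0n, of x "\<beta> * y"] by (simp add: e_mult)
  ultimately obtain \<beta>' and N :: nat where N: "N > 0"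
      "\<And>x y. E0 (bd \<beta>' *v x) y = of_nat N * E0 x (bd \<beta> *v y)"
    using form_from_polarization[OF E0, of ?G] by blast
  have "(\<Sum>j\<in>UNIV. S $ (p, i) $ (q, j) * of_real (r q \<beta>' $ j $ k))
      = of_nat N * (\<Sum>j\<in>UNIV. of_real (r p \<beta> $ j $ i) * S $ (p, j) $ (q, k))" for p q i k
  proof -
    have cnj_block: "cnj (block_matrix A $ d $ b) = block_matrix A $ d $ b"
      for A :: "'n \<Rightarrow> real^2^2" and d b by (simp add: block_matrix_def)
    show ?thesis
      using hermitian_matrix_adjoint[OF E0n E0n N(2), of "(p, i)" "(q, k)"]
        sum_block_matrix[of "\<lambda>d. S $ d $ (q, k)" "\<lambda>p. r p \<beta>" p i]
      by (simp add: bd_eq sum_block_matrix cnj_block S_def mult.commute)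
  qed
  with N(1) show ?thesis by blast
qed

text \<open>Extended by zero, a kernel vector of a diagonal block is isotropic for the whole form,
  which is definite.\<close>

lemma polarization_block_definite:
  assumes E0: "polarization \<Lambda> E0"
    and w: "\<And>i. (\<Sum>j\<in>UNIV. hermitian_matrix E0 $ (p, i) $ (p, j) * of_real (w $ j)) = 0"
  shows "w = (0 :: real^2)"
proof -
  have E0n: "E0 \<in> neron_severi \<Lambda>" using E0 by (simp add: polarization_def)
  define x :: "complex^('n \<times> 2)" where "x = (\<chi> a. if fst a = p then of_real (w $ snd a) else 0)"
  have Sx: "(hermitian_matrix E0 *v x) $ (p, i) = 0" for i
  proof -
    have "(hermitian_matrix E0 *v x) $ (p, i)
        = (\<Sum>q\<in>UNIV. if q = p then \<Sum>j\<in>UNIV. hermitian_matrix E0 $ (p, i) $ (p, j) * of_real (w $ j) else 0)"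
      unfolding matrix_vector_mult_def vec_lambda_beta sum_prod_2
      by (rule sum.cong) (simp_all add: x_def sum_2)
    then show ?thesis using w by simp
  qed
  have "hermitian_form E0 x x = 0"
    unfolding hermitian_form_matrix[OF E0n] sum_prod_2
  proof (rule sum.neutral, rule ballI)
    fix q
    have "x $ (q, i) = 0" if "q \<noteq> p" for i using that by (simp add: x_def)
    then show "cnj (x $ (q, 1)) * (hermitian_matrix E0 *v x) $ (q, 1)
        + cnj (x $ (q, 2)) * (hermitian_matrix E0 *v x) $ (q, 2) = 0"
      by (cases "q = p") (simp_all add: Sx)
  qed
  then have "x = 0" using E0 by (force simp: polarization_def)
  then have "x $ (p, i) = 0" for i by simp
  then show ?thesis by (simp add: x_def vec_eq_iff)
qed

text \<open>
  Definiteness of the diagonal blocks forces the adjoint to be the identity on the centre; a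
  central element with different images under the two embeddings then kills the block between them.
\<close>

lemma polarization_block_orthogonal:
  assumes E0: "polarization \<Lambda> E0" and "p \<noteq> q"
  shows "hermitian_matrix E0 $ (p, i) $ (q, k) = 0"
proof -
  let ?S = "hermitian_matrix E0"
  obtain a where a: "emb p a \<noteq> emb q a" using \<open>p \<noteq> q\<close> emb_separates by blast
  obtain m :: nat where m: "m > 0" "of_nat m * \<iota> a \<in> R" using order_multiple by blast
  define b where "b = of_nat m * a"
  have b: "\<iota> b \<in> R" "emb p b \<noteq> emb q b" using m a by (auto simp: b_def \<iota>_mult \<iota>_of_nat)
  obtain \<beta>' and N :: nat where N: "N > 0" and eq: "\<And>p q i k.
      (\<Sum>j\<in>UNIV. ?S $ (p, i) $ (q, j) * of_real (r q \<beta>' $ j $ k))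
        = of_nat N * (\<Sum>j\<in>UNIV. of_real (r p (\<iota> b) $ j $ i) * ?S $ (p, j) $ (q, k))"
    using adjoint_matrix[OF E0 b(1)] by blast
  have central: "(\<Sum>j\<in>UNIV. of_real (r p (\<iota> b) $ j $ i) * ?S $ (p, j) $ (q, k)) = of_real (emb p b) * ?S $ (p, i) $ (q, k)" for p q i k
    by (simp add: mat_def if_distrib[of of_real] if_distrib[of "\<lambda>x. x * _"] cong: if_cong)
  \<comment> \<open>On the diagonal block the adjunction says that every column of
    \<open>r p \<beta>'\<close> minus the scalar matrix of \<open>N * emb p b\<close> lies in the
    kernel of that block, so definiteness gives equality.\<close>
  have "r p \<beta>' = mat (of_nat N * emb p b)" for p
  proof -
    have "(\<chi> j. r p \<beta>' $ j $ k - (if j = k then of_nat N * emb p b else 0)) = (0 :: real^2)" for k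
    proof (rule polarization_block_definite[OF E0, of p])
      fix i
      have "(\<Sum>j\<in>UNIV. ?S $ (p, i) $ (p, j) * of_real (if j = k then of_nat N * emb p b else 0))
          = ?S $ (p, i) $ (p, k) * (of_nat N * of_real (emb p b))"
        by (simp add: if_distrib[of of_real] if_distrib[of "\<lambda>x. _ * x"] cong: if_cong)
      then show "(\<Sum>j\<in>UNIV. ?S $ (p, i) $ (p, j) *
          of_real ((\<chi> j. r p \<beta>' $ j $ k - (if j = k then of_nat N * emb p b else 0)) $ j)) = 0"
        using eq[of p i p k] unfolding central
        by (simp only: vec_lambda_beta of_real_diff right_diff_distrib sum_subtractf) simp
    qed
    then show ?thesis by (simp add: vec_eq_iff mat_def)
  qed
  \<comment> \<open>Between two embeddings the same relation has the scalar of \<open>q\<close> on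
    one side and that of \<open>p\<close> on the other.\<close>
  then have "?S $ (p, i) $ (q, k) * (of_nat N * of_real (emb q b)) = of_nat N * (of_real (emb p b) * ?S $ (p, i) $ (q, k))"
    using eq[of p i q k] unfolding central
    by (simp add: mat_def if_distrib[of of_real] if_distrib[of "\<lambda>x. _ * x"] cong: if_cong)
  then have "of_nat N * ((of_real (emb q b) - of_real (emb p b)) * ?S $ (p, i) $ (q, k)) = 0"
    by (simp add: algebra_simps)
  then show ?thesis using N b(2) by (simp flip: of_real_diff)
qed

text \<open>Writing \<open>S\<close> for the diagonal block, every real \<open>M\<close> has a real
  \<open>M'\<close> with \<open>S M' = M^T S\<close>: up to denominators this is the adjoint when
  \<open>M\<close> comes from the algebra, and it extends by linearity because those matrices span.
  For a hermitian \<open>S\<close> with positive diagonal, a single matrix unit \<open>M\<close>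
  then forces reality.\<close>

lemma polarization_block_real:
  assumes E0: "polarization \<Lambda> E0"
  shows "Im (hermitian_matrix E0 $ (p, i) $ (p, k)) = 0"
proof -
  let ?S = "hermitian_matrix E0"
  have E0n: "E0 \<in> neron_severi \<Lambda>" using E0 by (simp add: polarization_def)
  have adj: "\<exists>M' :: real^2^2. \<forall>i k. (\<Sum>j\<in>UNIV. ?S $ (p, i) $ (p, j) * of_real (M' $ j $ k))
      = (\<Sum>j\<in>UNIV. of_real (M $ j $ i) * ?S $ (p, j) $ (p, k))" (is "\<exists>M'. ?A M M'") for M :: "real^2^2"
  proof -
    have R: "\<exists>M'. ?A (r p x) M'" for x
    proof -
      obtain m :: nat where m: "m > 0" "of_nat m * x \<in> R" using order_multiple by blast
      have rm: "r p (of_nat m * x) = of_nat m *\<^sub>R r p x"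
        using r_scale[of p "of_nat m" x] by (simp add: \<iota>_of_nat)
      obtain \<beta>' and N :: nat where N: "N > 0" and eq: "\<And>i k.
        (\<Sum>j\<in>UNIV. ?S $ (p, i) $ (p, j) * of_real (r p \<beta>' $ j $ k))
          = of_nat N * (\<Sum>j\<in>UNIV. of_real (r p (of_nat m * x) $ j $ i) * ?S $ (p, j) $ (p, k))"
        using adjoint_matrix[OF E0 m(2)] by blast
      have "?A (r p x) ((1 / (of_nat N * of_nat m)) *\<^sub>R r p \<beta>')"
      proof (intro allI)
        fix i k
        have "of_nat N * of_nat m * (\<Sum>j\<in>UNIV. ?S $ (p, i) $ (p, j) * of_real (((1 / (of_nat N * of_nat m)) *\<^sub>R r p \<beta>') $ j $ k))
            = (\<Sum>j\<in>UNIV. ?S $ (p, i) $ (p, j) * of_real (r p \<beta>' $ j $ k))"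
          using N m(1) by (simp add: sum_distrib_left)
        also have "\<dots> = of_nat N * of_nat m * (\<Sum>j\<in>UNIV. of_real (r p x $ j $ i) * ?S $ (p, j) $ (p, k))"
          unfolding eq rm by (simp add: sum_distrib_left mult_ac)
        finally show "(\<Sum>j\<in>UNIV. ?S $ (p, i) $ (p, j) * of_real (((1 / (of_nat N * of_nat m)) *\<^sub>R r p \<beta>') $ j $ k))
            = (\<Sum>j\<in>UNIV. of_real (r p x $ j $ i) * ?S $ (p, j) $ (p, k))"
          using N m(1) by simp
      qed
      then show ?thesis by blast
    qed
    have "M \<in> span (range (r p))" by (simp add: span_range_r)
    then show ?thesis
    proof (induction rule: span_induct_alt)
      case base
      have "?A 0 0" by simp
      then show ?case by blast
    next
      case (step c x y)
      then obtain x' y' where "?A x x'" "?A y y'" using R by blast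
      then have "?A (c *\<^sub>R x + y) (c *\<^sub>R x' + y')"
        by (simp add: distrib_left distrib_right sum.distrib mult.left_commute[of _ "of_real c"] mult.assoc
            flip: sum_distrib_left)
      then show ?case by blast
    qed
  qed
  have herm: "?S $ (p, 2) $ (p, 1) = cnj (?S $ (p, 1) $ (p, 2))" "Im (?S $ (p, i) $ (p, i)) = 0" for i
    using hermitian_matrix_cnj[OF E0n] by (metis, metis Reals_cnj_iff complex_is_Real_iff)
  have pos: "Re (?S $ (p, i) $ (p, i)) > 0" for i
    using E0 by (auto simp: polarization_def hermitian_matrix_def axis_eq_0_iff)
  \<comment> \<open>For the matrix unit at \<open>(1, 1)\<close> the second column of
    \<open>S M'\<close> is \<open>(S12, 0)\<close>. With the real numbers \<open>u = M'12\<close>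
    and \<open>v = M'22\<close> this reads \<open>S11 u + S12 v = S12\<close> and
    \<open>S21 u + S22 v = 0\<close>. If \<open>u\<close> is nonzero, then \<open>S21\<close> is
    real; otherwise \<open>S22 > 0\<close> gives \<open>v = 0\<close> and hence
    \<open>S12 = 0\<close>.\<close>
  obtain M' :: "real^2^2" where M': "?A (\<chi> i j. if i = 1 \<and> j = 1 then 1 else 0) M'" using adj by blast
  have "?S $ (p, 2) $ (p, 1) * of_real (M' $ 1 $ 2) + ?S $ (p, 2) $ (p, 2) * of_real (M' $ 2 $ 2) = 0"
    using M'[rule_format, of 2 2] by (simp add: sum_2)
  moreover have "?S $ (p, 1) $ (p, 1) * of_real (M' $ 1 $ 2) + ?S $ (p, 1) $ (p, 2) * of_real (M' $ 2 $ 2) = ?S $ (p, 1) $ (p, 2)"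
    using M'[rule_format, of 1 2] by (simp add: sum_2)
  ultimately have "Im (?S $ (p, 1) $ (p, 2)) = 0"
    using herm(2)[of 1] herm(2)[of 2] pos[of 2] unfolding herm(1)
    by (cases "M' $ 1 $ 2 = 0") (auto simp: complex_eq_iff)
  then have "Im (?S $ (p, 1) $ (p, 2)) = 0" "Im (?S $ (p, 2) $ (p, 1)) = 0" by (simp_all add: herm(1))
  then show ?thesis using herm(2) exhaust_2[of i] exhaust_2[of k] by metis
qed

lemma neron_severi_block_matrix:
  assumes E: "E \<in> neron_severi \<Lambda>" and nondeg: "nondegenerate E"
  obtains P where "hermitian_matrix E = block_matrix P"
    "\<And>p. P p $ 1 $ 2 = P p $ 2 $ 1" "\<And>p. det (P p) \<noteq> 0"
proof -
  obtain E0 where E0: "polarization \<Lambda> E0" using abelian by (auto simp: abelian_variety_def)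
  have E0n: "E0 \<in> neron_severi \<Lambda>" using E0 by (simp add: polarization_def)
  let ?S = "hermitian_matrix E"
  obtain \<beta> and N :: nat where N: "N > 0" "\<And>x y. E0 (bd \<beta> *v x) y = of_nat N * E x y"
    using form_from_polarization[OF E0 neron_severiD(1,3)[OF E] neron_severi_rational[OF E]] by blast
  \<comment> \<open>Up to the factor \<open>N\<close>, the matrix of \<open>E\<close> is that of
    \<open>E0\<close> times \<open>bd \<beta>\<close>. Right multiplication by a real block diagonal
    matrix preserves both the vanishing between embeddings and the reality of the diagonal
    blocks.\<close>
  have eq: "of_nat N * ?S $ (p, i) $ (q, k) = (\<Sum>j\<in>UNIV. hermitian_matrix E0 $ (p, i) $ (q, j) * of_real (r q \<beta> $ j $ k))" for p q i k
  proof -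
    have "(\<Sum>d\<in>UNIV. cnj (mat 1 $ d $ (p, i)) * ?S $ d $ (q, k)) = ?S $ (p, i) $ (q, k)"
      by (simp add: mat_def if_distrib[of cnj] if_distrib[of "\<lambda>x. x * _"] cong: if_cong)
    then show ?thesis
      using hermitian_matrix_adjoint[OF E0n E, of "bd \<beta>" "of_nat N" "mat 1" "(p, i)" "(q, k)"] N(2)
      by (simp add: bd_eq sum_block_matrix)
  qed
  have off: "?S $ (p, i) $ (q, k) = 0" if "p \<noteq> q" for p q i k
    using eq[of p i q k] N(1) polarization_block_orthogonal[OF E0 that] by simp
  have re: "Im (?S $ (p, i) $ (p, k)) = 0" for p i k
  proof -
    have "Im (of_nat N * ?S $ (p, i) $ (p, k)) = 0"
      unfolding eq by (simp add: polarization_block_real[OF E0])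
    then show ?thesis using N(1) by simp
  qed
  define P :: "'n \<Rightarrow> real^2^2" where "P = (\<lambda>p. \<chi> i j. Re (?S $ (p, i) $ (p, j)))"
  have SP: "?S = block_matrix P"
    using off re by (auto simp: vec_eq_iff block_matrix_def P_def complex_eq_iff)
  moreover have "P p $ 1 $ 2 = P p $ 2 $ 1" for p
    using hermitian_matrix_cnj[OF E, of "(p, 1)" "(p, 2)"] by (simp add: P_def)
  moreover have "det (P p) \<noteq> 0" for p
  proof
    \<comment> \<open>A real kernel vector of one block, extended by zero, lies in the radical of
      \<open>E\<close>.\<close>
    assume "det (P p) = 0"
    then obtain w where w: "w \<noteq> 0" "P p *v w = 0"
      using invertible_det_nz[of "P p"] invertible_left_inverse[of "P p"] matrix_left_invertible_ker[of "P p"] by auto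
    define x :: "complex^('n \<times> 2)" where "x = (\<chi> a. if fst a = p then of_real (w $ snd a) else 0)"
    have "(?S *v x) $ (q, i) = 0" for q i
    proof -
      have "(?S *v x) $ (q, i) = (if q = p then of_real ((P p *v w) $ i) else 0)"
        by (auto simp: SP matrix_vector_mult_def sum_prod_2 sum_2 block_matrix_def x_def
            if_distrib[of "\<lambda>x. x * _"] if_distrib[of "\<lambda>x. _ * x"] if_distrib[of "\<lambda>x. x + _"] if_distrib[of "\<lambda>x. _ + x"] cong: if_cong)
      then show ?thesis using w by simp
    qed
    then have "?S *v x = 0" by (simp add: vec_eq_iff)
    then have "hermitian_form E x y = 0" for y by (simp add: hermitian_form_matrix[OF E])
    moreover have "E x y = Im (hermitian_form E x y)" for y by (simp add: hermitian_form_def)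
    ultimately have "E x y = 0" for y by simp
    then have "x = 0" using nondeg by (simp add: nondegenerate_def)
    then have "x $ (p, i) = 0" for i by simp
    then have "w = 0" by (simp add: x_def vec_eq_iff)
    with w show False by simp
  qed
  ultimately show ?thesis using that by blast
qed

end

section \<open>The index formula\<close>

abbreviation symplectic_unit :: "real^2^2" where
  "symplectic_unit \<equiv> vector [vector [0, 1], vector [- 1, 0]]"

text \<open>For positive determinant the answer depends only on the sign of
  \<open>P $ 1 $ 1\<close>, so only the first columns of \<open>N ** X\<close> and
  \<open>omega (det X) ** N\<close> are compared. Combining their two entries with weights from the
  first column of \<open>N\<close> eliminates \<open>P $ 2 $ 1\<close> and leaves a sum of
  squares.\<close>

lemma local_index_eq:
  fixes P N X :: "real^2^2" and t :: complex
  defines "X \<equiv> Im t *\<^sub>R (symplectic_unit ** P)"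
  assumes det: "det P \<noteq> 0" and t: "Im t \<noteq> 0"
    and N: "invertible N" and conj: "N ** X ** matrix_inv N = omega (det X)"
  shows "local_index (det X) N t = (if det P < 0 then 1 else if P $ 1 $ 1 > 0 then 0 else 2)"
proof -
  have X: "X $ 1 $ 1 = Im t * P $ 2 $ 1" "X $ 1 $ 2 = Im t * P $ 2 $ 2"
    "X $ 2 $ 1 = - (Im t * P $ 1 $ 1)" "X $ 2 $ 2 = - (Im t * P $ 1 $ 2)"
    by (simp_all add: X_def matrix_matrix_mult_def sum_2)
  have dX: "det X = (Im t)\<^sup>2 * det P"
    unfolding det_2 X by (simp add: power2_eq_square algebra_simps)
  have sgn: "det X < 0 \<longleftrightarrow> det P < 0" "det X > 0 \<longleftrightarrow> det P > 0"
    using t unfolding dX by (simp_all add: mult_less_0_iff zero_less_mult_iff)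
  show ?thesis
  proof (cases "det P < 0")
    case True
    then show ?thesis using sgn by (simp add: local_index_def)
  next
    case False
    then have d: "det X > 0" using det sgn by simp
    define s where "s = sqrt (det X)"
    have s: "s > 0" using d by (simp add: s_def)
    have "N ** X = N ** X ** (matrix_inv N ** N)"
      using N by (simp add: invertible_def matrix_inv_def someI_ex[of "\<lambda>A. N ** A = mat 1 \<and> A ** N = mat 1"])
    also have "\<dots> = omega (det X) ** N" by (simp only: matrix_mul_assoc conj)
    finally have "(N ** X) $ i $ j = (omega (det X) ** N) $ i $ j" for i j by simp
    from this[of 1 1] this[of 2 1]
    have eq: "N $ 1 $ 1 * (Im t * P $ 2 $ 1) - N $ 1 $ 2 * (Im t * P $ 1 $ 1) = s * N $ 2 $ 1"
      "N $ 2 $ 1 * (Im t * P $ 2 $ 1) - N $ 2 $ 2 * (Im t * P $ 1 $ 1) = - (s * N $ 1 $ 1)"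
      using d by (simp_all add: matrix_matrix_mult_def sum_2 X omega_def s_def)
    have "Im t * det N * P $ 1 $ 1
        = N $ 2 $ 1 * (N $ 1 $ 1 * (Im t * P $ 2 $ 1) - N $ 1 $ 2 * (Im t * P $ 1 $ 1))
          - N $ 1 $ 1 * (N $ 2 $ 1 * (Im t * P $ 2 $ 1) - N $ 2 $ 2 * (Im t * P $ 1 $ 1))"
      by (simp add: det_2 algebra_simps)
    also have "\<dots> = s * ((N $ 1 $ 1)\<^sup>2 + (N $ 2 $ 1)\<^sup>2)"
      unfolding eq by (simp add: power2_eq_square algebra_simps)
    finally have key: "(det N * Im t) * P $ 1 $ 1 = s * ((N $ 1 $ 1)\<^sup>2 + (N $ 2 $ 1)\<^sup>2)"
      by (simp add: mult.commute)
    have dN: "det N \<noteq> 0" using N by (simp add: invertible_det_nz)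
    then have "(N $ 1 $ 1)\<^sup>2 + (N $ 2 $ 1)\<^sup>2 > 0"
      by (auto simp: det_2 sum_power2_gt_zero_iff)
    then have "(det N * Im t) * P $ 1 $ 1 > 0" unfolding key using s by simp
    then have "det N * Im t > 0 \<longleftrightarrow> P $ 1 $ 1 > 0"
      unfolding zero_less_mult_iff[of "det N * Im t"] by linarith
    \<comment> \<open>This rules out the branch \<open>undefined\<close> of
      \<open>local_index\<close>.\<close>
    moreover have "det N * Im t \<noteq> 0" using dN t by simp
    ultimately show ?thesis using False d by (auto simp: local_index_def)
  qed
qed

text \<open>The value of a real 2x2 matrix as a sesquilinear form at \<open>(t, 1)\<close>: the
  diagonal entries contribute the real numbers \<open>a * |t|^2\<close> and \<open>d\<close>, so
  only the antisymmetric part survives.\<close>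

lemma Im_block:
  "Im (cnj t * (of_real a * t + of_real b) + (of_real c * t + of_real d)) = Im t * (c - b)"
  by (simp add: algebra_simps)

context quaternionic_torus
begin

text \<open>The origin of \<open>symplectic_unit\<close>: the antisymmetric part
  \<open>Q $ 2 $ 1 - Q $ 1 $ 2\<close> that survives on each block is
  \<open>trace (symplectic_unit ** Q)\<close>, here with \<open>Q\<close> equal to
  \<open>P p ** r p \<beta>\<close>.\<close>

lemma form_eq_trace:
  assumes E: "E \<in> neron_severi \<Lambda>" and P: "hermitian_matrix E = block_matrix P"
  shows "E (e \<beta>) v0 = (\<Sum>p\<in>UNIV. trace ((Im (\<tau> (emb p)) *\<^sub>R (symplectic_unit ** P p)) ** r p \<beta>))"
proof -
  let ?Q = "\<lambda>p. P p ** r p \<beta>"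
  have "hermitian_matrix E *v e \<beta> = block_matrix ?Q *v v0"
    by (simp add: P bd_eq matrix_vector_mul_assoc block_matrix_mult)
  moreover have "(block_matrix A *v v0) $ (p, i) = of_real (A p $ i $ 1) * \<tau> (emb p) + of_real (A p $ i $ 2)"
    for A :: "'n \<Rightarrow> real^2^2" and p i
  proof -
    have "(block_matrix A *v v0) $ (p, i)
        = (\<Sum>q\<in>UNIV. if q = p then of_real (A p $ i $ 1) * \<tau> (emb p) + of_real (A p $ i $ 2) else 0)"
      unfolding matrix_vector_mult_def vec_lambda_beta sum_prod_2
      by (rule sum.cong) (simp_all add: block_matrix_def base_vector_def)
    then show ?thesis by simp
  qed
  ultimately have Sv: "(hermitian_matrix E *v e \<beta>) $ (p, i)
      = of_real (?Q p $ i $ 1) * \<tau> (emb p) + of_real (?Q p $ i $ 2)" for p i by simp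
  have "E (e \<beta>) v0 = Im (hermitian_form E (e \<beta>) v0)" by (simp add: hermitian_form_def)
  also have "\<dots> = (\<Sum>p\<in>UNIV. Im (cnj (\<tau> (emb p)) * (of_real (?Q p $ 1 $ 1) * \<tau> (emb p) + of_real (?Q p $ 1 $ 2))
      + (of_real (?Q p $ 2 $ 1) * \<tau> (emb p) + of_real (?Q p $ 2 $ 2))))"
    unfolding hermitian_form_matrix[OF E] sum_prod_2 Sv Im_sum by (simp add: base_vector_def)
  also have "\<dots> = (\<Sum>p\<in>UNIV. Im (\<tau> (emb p)) * (?Q p $ 2 $ 1 - ?Q p $ 1 $ 2))"
    by (simp only: Im_block)
  also have "\<dots> = (\<Sum>p\<in>UNIV. trace ((Im (\<tau> (emb p)) *\<^sub>R (symplectic_unit ** P p)) ** r p \<beta>))"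
    by (rule sum.cong) (simp_all add: trace_def matrix_matrix_mult_def sum_2 algebra_simps)
  finally show ?thesis .
qed

text \<open>That the blocks on the right are images of one quaternion is not known in advance, so
  the comparison uses nondegeneracy of the trace pairing on arbitrary families of real
  matrices.\<close>

lemma line_bundle_quaternion_block:
  assumes E: "E \<in> neron_severi \<Lambda>" and P: "hermitian_matrix E = block_matrix P"
  shows "r p (line_bundle_quaternion \<iota> emb \<rho> \<tau> E) = Im (\<tau> (emb p)) *\<^sub>R (symplectic_unit ** P p)"
proof -
  note Eb = neron_severiD(1)[OF E]
  let ?\<mu> = "line_bundle_quaternion \<iota> emb \<rho> \<tau> E"
  have "\<exists>!\<mu>. \<forall>\<beta>. E (e \<beta>) v0 = quaternion_trace \<iota> (\<mu> * \<beta>)"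
    by (rule trace_form_represents)
      (use neron_severi_rational[OF E, of _ 1] in
        \<open>auto simp: e_1 e_add e_scale bilinear_ladd[OF Eb] bilinear_lmul[OF Eb]\<close>)
  then have \<mu>: "E (e \<beta>) v0 = quaternion_trace \<iota> (?\<mu> * \<beta>)" for \<beta>
    unfolding line_bundle_quaternion_def by (rule theI'[THEN spec])
  have "r p ?\<mu> - Im (\<tau> (emb p)) *\<^sub>R (symplectic_unit ** P p) = 0"
  proof (rule trace_form_nondegenerate[of "\<lambda>p. r p ?\<mu> - Im (\<tau> (emb p)) *\<^sub>R (symplectic_unit ** P p)"])
    fix \<beta>
    have "trace ((A - B) ** C) = trace (A ** C) - trace (B ** C)" for A B C :: "real^2^2"
      by (simp add: trace_def matrix_matrix_mult_def sum_2 algebra_simps)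
    then show "(\<Sum>p\<in>UNIV. trace ((r p ?\<mu> - Im (\<tau> (emb p)) *\<^sub>R (symplectic_unit ** P p)) ** r p \<beta>)) = 0"
      using \<mu>[of \<beta>] by (simp add: sum_subtractf form_eq_trace[OF E P] quaternion_trace_eq r_mult)
  qed
  then show ?thesis by simp
qed

text \<open>The eigenvector matrices of the blocks assemble to a block diagonal similarity, so
  negative eigenvalues are counted block by block.\<close>

lemma line_bundle_index_eq_sum:
  assumes P: "hermitian_matrix E = block_matrix P"
    and sym: "\<And>p. P p $ 1 $ 2 = P p $ 2 $ 1" and det: "\<And>p. det (P p) \<noteq> 0"
  shows "line_bundle_index E
    = (\<Sum>p\<in>UNIV. if det (P p) < 0 then 1 else if P p $ 1 $ 1 > 0 then 0 else 2)"
proof -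
  have "\<forall>p. \<exists>U D. det U \<noteq> 0 \<and> P p ** U = U ** (\<chi> i j. if i = j then D i else 0) \<and>
      card {i. D i < (0::real)} = (if det (P p) < 0 then 1 else if P p $ 1 $ 1 > 0 then 0 else 2)"
    by (intro allI symmetric_2x2_diagonalizable sym det)
  then obtain U D where UD: "\<And>p. det (U p) \<noteq> 0"
      "\<And>p. P p ** U p = U p ** (\<chi> i j. if i = j then D p i else 0)"
      "\<And>p. card {i. D p i < (0::real)} = (if det (P p) < 0 then 1 else if P p $ 1 $ 1 > 0 then 0 else 2)"
    unfolding choice_iff by blast
  have diag: "(\<chi> a b. if a = b then of_real (D (fst a) (snd a)) else 0)
      = block_matrix (\<lambda>p. \<chi> i j. if i = j then D p i else 0)"
    by (auto simp: vec_eq_iff block_matrix_def)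
  have "line_bundle_index E = card {a. D (fst a) (snd a) < 0}"
  proof (rule line_bundle_index_eq_card)
    show "invertible (block_matrix U)" using UD(1) by (intro invertible_block_matrix) (simp add: invertible_det_nz)
    show "hermitian_matrix E ** block_matrix U
        = block_matrix U ** (\<chi> a b. if a = b then of_real (D (fst a) (snd a)) else 0)"
      unfolding diag by (simp add: P block_matrix_mult UD(2))
  qed
  also have "{a. D (fst a) (snd a) < 0} = Sigma UNIV (\<lambda>p. {i. D p i < 0})" by auto
  also have "card \<dots> = (\<Sum>p\<in>UNIV. card {i. D p i < 0})" by simp
  finally show ?thesis by (simp add: UD(3))
qed

lemma index_formula:
  assumes E: "E \<in> neron_severi \<Lambda>" "nondegenerate E"
    and \<mu>: "\<mu> = line_bundle_quaternion \<iota> emb \<rho> \<tau> E"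
    and \<tau>: "\<And>p. Im (\<tau> (emb p)) \<noteq> 0"
    and \<nu>: "\<And>p. invertible (\<nu> (emb p))"
    and conj: "\<And>p. \<nu> (emb p) ** r p \<mu> ** matrix_inv (\<nu> (emb p)) = omega (emb p (quaternion_delta \<iota> \<mu>))"
  shows "line_bundle_index E
    = (\<Sum>p\<in>UNIV. local_index (emb p (quaternion_delta \<iota> \<mu>)) (\<nu> (emb p)) (\<tau> (emb p)))"
proof -
  obtain P where P: "hermitian_matrix E = block_matrix P"
    "\<And>p. P p $ 1 $ 2 = P p $ 2 $ 1" "\<And>p. det (P p) \<noteq> 0"
    by (rule neron_severi_block_matrix[OF E]) blast
  have r\<mu>: "r p \<mu> = Im (\<tau> (emb p)) *\<^sub>R (symplectic_unit ** P p)" for p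
    unfolding \<mu> by (rule line_bundle_quaternion_block[OF E(1) P(1)])
  \<comment> \<open>The trace of \<open>symplectic_unit ** P p\<close> is
    \<open>P p $ 2 $ 1 - P p $ 1 $ 2\<close>, so the symmetry of the blocks is what makes \<mu>
    pure.\<close>
  have \<delta>: "emb p (quaternion_delta \<iota> \<mu>) = det (Im (\<tau> (emb p)) *\<^sub>R (symplectic_unit ** P p))" for p
    unfolding r\<mu>[symmetric]
    by (rule emb_quaternion_delta) (simp add: r\<mu> trace_scaleR trace_def matrix_matrix_mult_def sum_2 P(2))
  show ?thesis
    unfolding line_bundle_index_eq_sum[OF P] \<delta>
    by (rule sum.cong[OF refl], rule local_index_eq[symmetric, OF P(3) \<tau> \<nu>]) (use conj in \<open>simp only: r\<mu> \<delta>\<close>)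
qed

end

theorem theorem5p1:
  fixes \<iota> :: "'f::field_char_0 \<Rightarrow> 'b::division_ring"
    and emb :: "'n::finite \<Rightarrow> 'f \<Rightarrow> real"
    and \<rho> :: "('f \<Rightarrow> real) \<Rightarrow> 'b \<Rightarrow> real^2^2"
    and R I :: "'b set"
    and \<tau> :: "('f \<Rightarrow> real) \<Rightarrow> complex"
    and E :: "complex^('n \<times> 2) \<Rightarrow> complex^('n \<times> 2) \<Rightarrow> real"
    and \<mu> :: "'b" and \<delta> :: "'f"
    and \<nu> :: "('f \<Rightarrow> real) \<Rightarrow> real^2^2"
  assumes "totally_real_number_field TYPE('f)"
    and "field_degree TYPE('f) = CARD('n)"
    and "bij_betw emb UNIV real_embeddings"
    and "quaternion_algebra \<iota>"
    and "totally_indefinite \<iota>"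
    and "\<And>\<sigma>. \<sigma> \<in> real_embeddings \<Longrightarrow> splitting \<iota> \<sigma> (\<rho> \<sigma>)"
    and "quaternion_order \<iota> R" and "hereditary R"
    and "left_order_ideal \<iota> R I"
    and "\<And>\<sigma>. \<sigma> \<in> real_embeddings \<Longrightarrow> Im (\<tau> \<sigma>) \<noteq> 0"
    and "abelian_variety (qm_lattice emb \<rho> \<tau> I)"
    and "quaternionic_multiplication emb \<rho> R (qm_lattice emb \<rho> \<tau> I)"
    and "E \<in> neron_severi (qm_lattice emb \<rho> \<tau> I)"
    and "nondegenerate E"
    and "\<mu> = line_bundle_quaternion \<iota> emb \<rho> \<tau> E"
    and "\<delta> = quaternion_delta \<iota> \<mu>"
    and "\<And>\<sigma>. \<sigma> \<in> real_embeddings \<Longrightarrow> invertible (\<nu> \<sigma>)"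
    and "\<And>\<sigma>. \<sigma> \<in> real_embeddings \<Longrightarrow>
           \<nu> \<sigma> ** \<rho> \<sigma> \<mu> ** matrix_inv (\<nu> \<sigma>) = omega (\<sigma> \<delta>)"
  shows "line_bundle_index E = (\<Sum>\<sigma>\<in>real_embeddings. local_index (\<sigma> \<delta>) (\<nu> \<sigma>) (\<tau> \<sigma>))"
proof -
  interpret quaternionic_torus emb \<iota> \<rho> R I \<tau>
    by unfold_locales (use assms bij_betwE[OF assms(3)] in auto)
  have emb: "emb p \<in> real_embeddings" for p using bij_betwE[OF assms(3)] by blast
  show ?thesis
    unfolding sum_real_embeddings \<open>\<delta> = quaternion_delta \<iota> \<mu>\<close>
    by (rule index_formula[OF assms(13,14,15)])
      (use assms(10,17) assms(18)[unfolded \<open>\<delta> = quaternion_delta \<iota> \<mu>\<close>] emb in auto)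
qed

end
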